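(* Let $\mathbb T^3_{2\pi}=(\mathbb R/2\pi\mathbb Z)^3$. Fix $a\in\mathbb T^3_{2\pi}$, $T>0$ and $\nu\ge0$. There exists an open neighborhood $\mathcal U=\mathcal U(a,T,\nu)$ of $\mathrm{Id}$ in $\mathrm{SL}(3,\mathbb R)$ such that every $F_*\in\mathcal U$ is realized as $$\nabla_aX(a,T)=F_*$$ where $X$ is the Lagrangian flow of an exact real-analytic periodic unforced solution of the Euler equations when $\nu=0$, and of an exact real-analytic periodic unforced solution of the Navier--Stokes equations with viscosity $\nu$ when $\nu>0$.
   Context: The equations are $\partial_tu+u\cdot\nabla u+\nabla p=\nu\Delta u$, $\nabla\cdot u=0$ on $\mathbb T^3_{2\pi}$ with no external force; $\nu=0$ is Euler and $\nu>0$ is Navier--Stokes. The Lagrangian flow is defined by $\partial_tX(a,t)=u(X(a,t),t)$, $X(a,0)=a$, and $\nabla_aX(a,t)$ is the Jacobian matrix of $X(\cdot,t)$ at $a$. *)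

theory Defs
  imports "HOL-Analysis.Analysis"
begin

definition SL3 :: "(real^3^3) set" where
  "SL3 = {F. det F = 1}"

(* Real-analyticity in several variables: near every point of S, the function is the sum of a
   power series in the coordinates. The multi-indices are the extensional functions
   Basis \<rightarrow> nat; the sum is unconditional, hence absolutely convergent for finite-dimensional
   targets. The expansion holds on a full ball, so at a boundary point of S it
   also describes f slightly outside S. *)
definition real_analytic_on ::
  "('a::euclidean_space \<Rightarrow> 'b::real_normed_vector) \<Rightarrow> 'a set \<Rightarrow> bool"
  (infixl "real'_analytic'_on" 50) where
  "f real_analytic_on S \<longleftrightarrow>
     (\<forall>x\<in>S. \<exists>r>0. \<exists>c :: ('a \<Rightarrow> nat) \<Rightarrow> 'b. \<forall>y\<in>ball x r.
        ((\<lambda>\<alpha>. (\<Prod>b\<in>Basis. ((y - x) \<bullet> b) ^ \<alpha> b) *\<^sub>R c \<alpha>) has_sum f y) (Basis \<rightarrow>\<^sub>E UNIV))"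

definition partial_deriv ::
  "'n::finite \<Rightarrow> (real^'n \<Rightarrow> 'b::real_normed_vector) \<Rightarrow> real^'n \<Rightarrow> 'b" where
  "partial_deriv i f x = frechet_derivative f (at x) (axis i 1)"

definition gradient :: "(real^'n \<Rightarrow> real) \<Rightarrow> real^'n \<Rightarrow> real^'n" where
  "gradient f x = (\<chi> i. partial_deriv i f x)"

definition divergence :: "(real^'n \<Rightarrow> real^'n) \<Rightarrow> real^'n \<Rightarrow> real" where
  "divergence v x = (\<Sum>i\<in>UNIV. partial_deriv i (\<lambda>y. v y $ i) x)"

definition laplacian ::
  "(real^'n \<Rightarrow> 'b::real_normed_vector) \<Rightarrow> real^'n \<Rightarrow> 'b" where
  "laplacian f x = (\<Sum>i\<in>UNIV. partial_deriv i (partial_deriv i f) x)"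

(* (v . nabla) w *)
definition advection ::
  "(real^'n \<Rightarrow> real^'n) \<Rightarrow> (real^'n \<Rightarrow> 'b::real_normed_vector) \<Rightarrow> real^'n \<Rightarrow> 'b" where
  "advection v w x = (\<Sum>j\<in>UNIV. (v x $ j) *\<^sub>R partial_deriv j w x)"

(* Functions on the torus (R / 2 pi Z)^3 are represented by their 2 pi-periodic lifts to R^3. *)
definition torus_periodic :: "(real^'n \<Rightarrow> 'b) \<Rightarrow> bool" where
  "torus_periodic f \<longleftrightarrow> (\<forall>x i. f (x + axis i (2 * pi)) = f x)"

(* Unforced incompressible equations on the time interval [0,T], for velocity u t x and pressure
   p t x: Euler for nu = 0, Navier--Stokes with viscosity nu for nu > 0. Analyticity is joint in
   time and space, up to and including the end points of [0,T]; all the derivatives below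
   therefore exist. *)
definition analytic_periodic_solution ::
  "real \<Rightarrow> real \<Rightarrow> (real \<Rightarrow> real^3 \<Rightarrow> real^3) \<Rightarrow> (real \<Rightarrow> real^3 \<Rightarrow> real) \<Rightarrow> bool" where
  "analytic_periodic_solution \<nu> T u p \<longleftrightarrow>
     (\<lambda>(t, x). u t x) real_analytic_on ({0..T} \<times> UNIV) \<and>
     (\<lambda>(t, x). p t x) real_analytic_on ({0..T} \<times> UNIV) \<and>
     (\<forall>t\<in>{0..T}. torus_periodic (u t) \<and> torus_periodic (p t)) \<and>
     (\<forall>t\<in>{0..T}. \<forall>x.
        vector_derivative (\<lambda>s. u s x) (at t within {0..T}) + advection (u t) (u t) x
          + gradient (p t) x = \<nu> *\<^sub>R laplacian (u t) x \<and>
        divergence (u t) x = 0)"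

(* The flow is lifted to R^3 as well: its spatial Jacobian does not depend on the
   choice of the lift. *)
definition lagrangian_flow ::
  "real \<Rightarrow> (real \<Rightarrow> real^3 \<Rightarrow> real^3) \<Rightarrow> (real^3 \<Rightarrow> real \<Rightarrow> real^3) \<Rightarrow> bool" where
  "lagrangian_flow T u X \<longleftrightarrow>
     (\<forall>b. X b 0 = b \<and>
        (\<forall>t\<in>{0..T}. (X b has_vector_derivative u t (X b t)) (at t within {0..T})))"

end

(* The Beltrami fields v with curl v = sqrt 2 v form a linear space of steady Euler flows, and
   exp (-2 nu t) v solves Navier--Stokes, so both equations are satisfied exactly by a linear family
   of explicit trigonometric fields. Already the waves with wave vectors e_i +- e_j realize every
   trace-free matrix A as the gradient of v at a. For small A the Jacobian of the flow at time T is
   1 + tau A + O(|A|^2) and continuous in A, so Brouwer's theorem realizes any eight entries near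
   those of the identity; the ninth is then fixed by det = 1. As A is small, the Lipschitz constant
   times T is at most 1/2, so every ODE estimate is a single absorption on [0, T]. *)

theory Submission
  imports Defs
begin

section \<open>Differential equations over short times\<close>

text \<open>All Jacobians lie in the hypersurface \<open>SL3\<close>, so they cannot fill a
  neighborhood of the identity among the 3x3 matrices. This is why one entry is projected away; the
  entry (3,3) can be recovered because \<open>det\<close> is affine in it, with the upper left 2x2
  minor as coefficient, and that minor is 1 at the identity. Brouwer's theorem takes the place of an
  inverse function theorem: the Jacobian need only be Lipschitz in \<open>A\<close> with a quadratic
  error, and no derivative in \<open>A\<close> is ever taken. A sum of waves is Beltrami only if all
  wave vectors have the same length. The axes e_i would not do: an amplitude is orthogonal to its
  wave vector, so they only produce gradients at \<open>a\<close> with zero diagonal. The vectors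
  e_i +- e_j are the next shell of integer vectors. Viscosity enters only through the factor
  \<open>g\<close>, with values in (0,1], and its integral \<open>\<tau>\<close> over [0,T]. Since
  \<open>\<tau>\<close> is positive for every \<open>T\<close> and \<open>\<nu>\<close>, neither has
  to be small; only the amplitudes are.\<close>

lemma continuous_on_along:
  fixes f :: "real \<Rightarrow> 'a::topological_space \<Rightarrow> 'b::topological_space"
  assumes "continuous_on (I \<times> UNIV) (\<lambda>(t, x). f t x)" and "continuous_on I X"
  shows "continuous_on I (\<lambda>s. f s (X s))"
proof -
  have "continuous_on I ((\<lambda>(t, x). f t x) \<circ> (\<lambda>s. (s, X s)))"
    by (intro continuous_on_compose continuous_on_Pair continuous_on_id assms(2)
        continuous_on_subset[OF assms(1)]) auto
  then show ?thesis by (simp add: o_def)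
qed

lemma norm_integral_le_const:
  fixes h :: "real \<Rightarrow> 'a::banach"
  assumes "continuous_on {0..T} h" "t \<in> {0..T}" "\<And>s. s \<in> {0..T} \<Longrightarrow> norm (h s) \<le> m"
  shows "norm (integral {0..t} h) \<le> m * T"
proof -
  have "continuous_on {0..t} h"
    by (rule continuous_on_subset[OF assms(1)]) (use assms(2) in auto)
  then have "norm (integral {0..t} h) \<le> m * (t - 0)"
    using assms(2,3) by (intro integral_bound) auto
  moreover have "0 \<le> m"
    using assms(2) assms(3)[of t] norm_ge_zero[of "h t"] by linarith
  ultimately show ?thesis
    using assms(2) mult_left_mono[of t T m] by simp
qed

text \<open>The bound \<open>L * T \<le> 1/2\<close> makes the integral operator a contraction with
  factor 1/2 in the sup norm over all of [0,T], so a single fixed point gives the whole curve,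
  without continuation in time.\<close>

lemma picard_exists:
  fixes f :: "real \<Rightarrow> 'a::banach \<Rightarrow> 'a"
  assumes T: "0 \<le> T" and L: "0 \<le> L" "L * T \<le> 1/2"
    and cont: "continuous_on ({0..T} \<times> UNIV) (\<lambda>(t, x). f t x)"
    and lip: "\<And>t x y. t \<in> {0..T} \<Longrightarrow> norm (f t x - f t y) \<le> L * norm (x - y)"
  shows "\<exists>X. continuous_on {0..T} X \<and>
    (\<forall>t\<in>{0..T}. X t = x0 + integral {0..t} (\<lambda>s. f s (X s)))"
proof -
  \<comment> \<open>Banach's theorem is applied in the complete space of bounded continuous curves
    on the whole line, so time is clamped to [0,T] and \<open>P X\<close> is constant
    outside.\<close>
  define cl where "cl t = max 0 (min T t)" for t :: real
  have cl: "cl t \<in> {0..T}" "t \<in> {0..T} \<Longrightarrow> cl t = t" for t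
    using T by (auto simp: cl_def)
  have cont_cl: "continuous_on UNIV cl"
    unfolding cl_def by (intro continuous_intros)
  define P where "P X t = x0 + integral {0..cl t} (\<lambda>s. f s (apply_bcontfun X s))"
    for X :: "real \<Rightarrow>\<^sub>C 'a" and t
  have cf: "continuous_on {0..T} (\<lambda>s. f s (apply_bcontfun X s))" for X
    by (rule continuous_on_along[OF cont]) simp
  have PB: "P X \<in> bcontfun" for X
  proof -
    let ?I = "\<lambda>t. integral {0..t} (\<lambda>s. f s (apply_bcontfun X s))"
    have I: "continuous_on {0..T} ?I"
      using cf by (intro indefinite_integral_continuous_1 integrable_continuous_interval)
    have "continuous_on UNIV (\<lambda>t. ?I (cl t))"
      by (rule continuous_on_compose2[OF I cont_cl]) (use cl in auto)
    then have "continuous_on UNIV (P X)"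
      unfolding P_def by (intro continuous_intros)
    moreover obtain B where B: "\<forall>y\<in>?I ` {0..T}. norm y \<le> B"
      using compact_imp_bounded[OF compact_continuous_image[OF I compact_Icc]]
      unfolding bounded_iff by blast
    moreover have "norm (P X t) \<le> norm x0 + B" for t
    proof -
      have "norm (?I (cl t)) \<le> B" using B cl(1)[of t] by blast
      then show ?thesis unfolding P_def by (rule norm_triangle_le[OF add_left_mono])
    qed
    ultimately show ?thesis
      by (intro bcontfun_normI[of "P X" "norm x0 + B"])
  qed
  have app: "apply_bcontfun (Bcontfun (P X)) = P X" for X
    using PB by (simp add: Bcontfun_inverse)
  have "dist (Bcontfun (P X)) (Bcontfun (P Y)) \<le> 1/2 * dist X Y" for X Y
  proof (rule dist_bound, unfold app)
    fix t
    have "P X t - P Y t = integral {0..cl t} (\<lambda>s. f s (apply_bcontfun X s) - f s (apply_bcontfun Y s))"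
      unfolding P_def using cl(1)[of t]
      using integrable_continuous_interval[OF continuous_on_subset[OF cf]]
      by (subst integral_diff) auto
    moreover have "norm \<dots> \<le> (L * dist X Y) * T"
    proof (rule norm_integral_le_const[OF _ cl(1)])
      fix s assume "s \<in> {0..T}"
      then have "norm (f s (apply_bcontfun X s) - f s (apply_bcontfun Y s))
          \<le> L * dist (apply_bcontfun X s) (apply_bcontfun Y s)"
        unfolding dist_norm by (rule lip)
      also have "\<dots> \<le> L * dist X Y"
        by (intro mult_left_mono dist_bounded L)
      finally show "norm (f s (apply_bcontfun X s) - f s (apply_bcontfun Y s)) \<le> L * dist X Y" .
    qed (intro continuous_intros cf)
    moreover have "(L * dist X Y) * T \<le> 1/2 * dist X Y"
      using mult_right_mono[OF L(2), of "dist X Y"] by (simp add: mult_ac)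
    ultimately show "dist (P X t) (P Y t) \<le> 1/2 * dist X Y"
      by (simp add: dist_norm)
  qed
  then have "\<exists>!X. Bcontfun (P X) = X"
    by (intro banach_fix_type[where c = "1/2"]) auto
  then obtain X where "Bcontfun (P X) = X" by blast
  then have "apply_bcontfun X t = P X t" for t
    using app by metis
  from this[unfolded P_def]
  have "apply_bcontfun X t = x0 + integral {0..t} (\<lambda>s. f s (apply_bcontfun X s))"
    if "t \<in> {0..T}" for t
    using cl(2)[OF that] by metis
  then show ?thesis
    using continuous_on_apply_bcontfun by blast
qed

text \<open>At the maximum of \<open>norm w\<close>, the assumption \<open>L * T \<le> 1/2\<close> allows to absorb the integral term
  into the left-hand side.\<close>

lemma short_time_gronwall:
  fixes w :: "real \<Rightarrow> 'a::banach"
  assumes L: "0 \<le> L" "L * T \<le> 1/2"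
    and cont: "continuous_on {0..T} w" "continuous_on {0..T} h"
    and eq: "\<And>t. t \<in> {0..T} \<Longrightarrow> w t = e + integral {0..t} h"
    and h: "\<And>s. s \<in> {0..T} \<Longrightarrow> norm (h s) \<le> L * norm (w s) + d"
    and t: "t \<in> {0..T}"
  shows "norm (w t) \<le> 2 * (norm e + d * T)"
proof -
  have "continuous_on {0..T} (\<lambda>s. norm (w s))"
    using cont by (intro continuous_intros)
  then obtain m where m: "m \<in> {0..T}" "\<And>s. s \<in> {0..T} \<Longrightarrow> norm (w s) \<le> norm (w m)"
    using continuous_attains_sup[of "{0..T}" "\<lambda>s. norm (w s)"] t by fastforce
  have "norm (h s) \<le> L * norm (w m) + d" if "s \<in> {0..T}" for s
    using h[OF that] mult_left_mono[OF m(2)[OF that] L(1)] by linarith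
  then have "norm (integral {0..m} h) \<le> (L * norm (w m) + d) * T"
    by (rule norm_integral_le_const[OF cont(2) m(1)])
  then have "norm (w m) \<le> norm e + (L * norm (w m) + d) * T"
    unfolding eq[OF m(1)] by (rule norm_triangle_le[OF add_left_mono])
  moreover have "L * norm (w m) * T \<le> 1/2 * norm (w m)"
    using mult_right_mono[OF L(2), of "norm (w m)"] by (simp add: mult_ac)
  ultimately have "norm (w m) \<le> 2 * (norm e + d * T)"
    by (simp add: algebra_simps)
  then show ?thesis using m(2)[OF t] by linarith
qed

lemma has_derivative_quadratic:
  assumes "bounded_linear f'"
    and "\<And>y. norm (f y - f x - f' (y - x)) \<le> M * (norm (y - x))\<^sup>2"
  shows "(f has_derivative f') (at x)"
  unfolding has_derivative_at_alt
proof (intro conjI assms(1) allI impI)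
  fix e :: real assume e: "0 < e"
  show "\<exists>d>0. \<forall>y. norm (y - x) < d \<longrightarrow> norm (f y - f x - f' (y - x)) \<le> e * norm (y - x)"
  \<comment> \<open>\<open>M\<close> may be zero or negative; \<open>\<bar>M\<bar> + 1\<close> is
    positive and dominates it.\<close>
  proof (intro exI[of _ "e / (\<bar>M\<bar> + 1)"] conjI allI impI)
    fix y assume "norm (y - x) < e / (\<bar>M\<bar> + 1)"
    then have "(\<bar>M\<bar> + 1) * norm (y - x) \<le> e"
      by (simp add: field_simps)
    then have "(\<bar>M\<bar> + 1) * norm (y - x) * norm (y - x) \<le> e * norm (y - x)"
      by (intro mult_right_mono) auto
    moreover have "M * (norm (y - x))\<^sup>2 \<le> (\<bar>M\<bar> + 1) * norm (y - x) * norm (y - x)"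
      unfolding power2_eq_square mult.assoc by (intro mult_right_mono) auto
    ultimately show "norm (f y - f x - f' (y - x)) \<le> e * norm (y - x)"
      using assms(2)[of y] by linarith
  qed (use e in simp)
qed

lemma integral_eq_has_vector_derivative:
  fixes X :: "real \<Rightarrow> 'a::banach"
  assumes "continuous_on {0..T} h" "\<And>t. t \<in> {0..T} \<Longrightarrow> X t = x0 + integral {0..t} h"
    and t: "t \<in> {0..T}"
  shows "(X has_vector_derivative h t) (at t within {0..T})"
proof -
  have "((\<lambda>t. x0 + integral {0..t} h) has_vector_derivative 0 + h t) (at t within {0..T})"
    by (intro has_vector_derivative_add has_vector_derivative_const
        integral_has_vector_derivative assms)
  then show ?thesis
    using assms(2) t by (auto intro: has_vector_derivative_transform)
qed

text \<open>Puts the difference of two solutions into the form to which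
  \<open>short_time_gronwall\<close> applies.\<close>

lemma diff_integral_eqs:
  fixes X Y :: "'a::banach" and t T :: real
  assumes "continuous_on {0..T} h" "continuous_on {0..T} k" "t \<in> {0..T}"
    and "X = x + integral {0..t} h" "Y = y + integral {0..t} k"
  shows "X - Y = (x - y) + integral {0..t} (\<lambda>s. h s - k s)"
proof -
  have "{0..t} \<subseteq> {0..T}"
    using assms(3) by auto
  then have "h integrable_on {0..t}" "k integrable_on {0..t}"
    using assms(1,2) by (blast intro: integrable_continuous_interval continuous_on_subset)+
  then show ?thesis using assms(4,5) by (simp add: integral_diff)
qed

section \<open>The flow of a small field and its linearization\<close>

text \<open>Separates the differential equations from the trigonometry. The velocity is
  \<open>g t *\<^sub>R v A x\<close>, and \<open>v_taylor\<close> says that \<open>D A x\<close> is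
  the derivative of \<open>v A\<close> at \<open>x\<close>. The bounds carry a factor
  \<open>norm A\<close> or \<open>norm (A - B)\<close>, as for fields linear in \<open>A\<close>, so
  for fixed \<open>T\<close> the Lipschitz constant becomes small with \<open>A\<close>.\<close>

locale small_flow =
  fixes v :: "'p::real_normed_vector \<Rightarrow> 'a::euclidean_space \<Rightarrow> 'a"
    and D :: "'p \<Rightarrow> 'a \<Rightarrow> 'a \<Rightarrow>\<^sub>L 'a"
    and g :: "real \<Rightarrow> real" and T C :: real
  assumes T: "0 < T" and C: "0 \<le> C"
    and g_cont: "continuous_on {0..T} g"
    and g_bound: "\<And>t. t \<in> {0..T} \<Longrightarrow> \<bar>g t\<bar> \<le> 1"
    and v_param: "\<And>A B x. norm (v A x - v B x) \<le> C * norm (A - B)"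
    and v_zero: "\<And>x. v 0 x = 0"
    and v_lip: "\<And>A x y. norm (v A x - v A y) \<le> C * norm A * norm (x - y)"
    and v_taylor: "\<And>A x y. norm (v A y - v A x - D A x (y - x)) \<le> C * norm A * (norm (y - x))\<^sup>2"
    and D_param: "\<And>A B x. norm (D A x - D B x) \<le> C * norm (A - B)"
    and D_zero: "\<And>x. D 0 x = 0"
    and D_lip: "\<And>A x y. norm (D A x - D A y) \<le> C * norm A * norm (x - y)"
begin

definition small :: "'p \<Rightarrow> bool" where "small A \<longleftrightarrow> C * norm A * T \<le> 1/2"

lemma v_bound: "norm (v A x) \<le> C * norm A"
  using v_param[of A x 0] by (simp add: v_zero)

lemma D_bound: "norm (D A x) \<le> C * norm A"
  using D_param[of A x 0] by (simp add: D_zero)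

lemma v_cont: "continuous_on UNIV (v A)"
proof (rule lipschitz_on_continuous_on)
  show "(C * norm A)-lipschitz_on UNIV (v A)"
    using v_lip[of A] C by (intro lipschitz_onI) (auto simp: dist_norm)
qed

lemma D_cont: "continuous_on UNIV (D A)"
proof (rule lipschitz_on_continuous_on)
  show "(C * norm A)-lipschitz_on UNIV (D A)"
    using D_lip[of A] C by (intro lipschitz_onI) (auto simp: dist_norm)
qed

lemma g_mult: "t \<in> {0..T} \<Longrightarrow> norm (z::'z::real_normed_vector) \<le> m \<Longrightarrow> norm (g t *\<^sub>R z) \<le> m"
  using g_bound[of t] mult_mono[of "\<bar>g t\<bar>" 1 "norm z" m] by simp

text \<open>The choice is made for every \<open>A\<close>, but only under \<open>small A\<close>
  does the Picard argument show that such a curve exists.\<close>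

definition flow :: "'p \<Rightarrow> 'a \<Rightarrow> real \<Rightarrow> 'a" where
  "flow A b = (SOME X. continuous_on {0..T} X \<and>
    (\<forall>t\<in>{0..T}. X t = b + integral {0..t} (\<lambda>s. g s *\<^sub>R v A (X s))))"

text \<open>The first variational equation along the trajectory, started at the identity. Nothing
  here refers to a derivative of \<open>flow\<close>; \<open>flow_has_derivative\<close> makes the
  connection at time \<open>T\<close>.\<close>

definition tangent :: "'p \<Rightarrow> 'a \<Rightarrow> real \<Rightarrow> 'a \<Rightarrow>\<^sub>L 'a" where
  "tangent A b = (SOME J. continuous_on {0..T} J \<and>
    (\<forall>t\<in>{0..T}. J t = id_blinfun + integral {0..t} (\<lambda>s. g s *\<^sub>R (D A (flow A b s) o\<^sub>L J s))))"

context
  fixes A :: 'p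
  assumes small: "small A"
begin

lemma small': "C * norm A * T \<le> 1/2" "0 \<le> C * norm A" "0 \<le> T"
  using small C T by (auto simp: small_def)

lemma flow: "continuous_on {0..T} (flow A b)"
  "t \<in> {0..T} \<Longrightarrow> flow A b t = b + integral {0..t} (\<lambda>s. g s *\<^sub>R v A (flow A b s))"
proof -
  have c: "continuous_on ({0..T} \<times> UNIV) (\<lambda>(t, x). g t *\<^sub>R v A x)"
    unfolding case_prod_beta
    by (intro continuous_on_scaleR continuous_on_compose2[OF g_cont continuous_on_fst]
        continuous_on_compose2[OF v_cont continuous_on_snd] continuous_on_id) auto
  have l: "norm (g t *\<^sub>R v A x - g t *\<^sub>R v A y) \<le> C * norm A * norm (x - y)"
    if "t \<in> {0..T}" for t x y
    unfolding scaleR_right_diff_distrib[symmetric] by (intro g_mult that v_lip)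
  have "continuous_on {0..T} (flow A b) \<and>
    (\<forall>t\<in>{0..T}. flow A b t = b + integral {0..t} (\<lambda>s. g s *\<^sub>R v A (flow A b s)))"
    unfolding flow_def using picard_exists[OF small'(3,2,1) c l] by (rule someI_ex)
  then show "continuous_on {0..T} (flow A b)"
    "t \<in> {0..T} \<Longrightarrow> flow A b t = b + integral {0..t} (\<lambda>s. g s *\<^sub>R v A (flow A b s))"
    by blast+
qed

lemma flow_rhs_cont: "continuous_on {0..T} (\<lambda>s. g s *\<^sub>R v A (flow A b s))"
  by (intro continuous_on_scaleR g_cont continuous_on_compose2[OF v_cont flow(1)]) auto

lemma D_flow_cont: "continuous_on {0..T} (\<lambda>s. D A (flow A b s))"
  by (intro continuous_on_compose2[OF D_cont flow(1)]) auto

lemma tangent: "continuous_on {0..T} (tangent A b)"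
  "t \<in> {0..T} \<Longrightarrow> tangent A b t =
    id_blinfun + integral {0..t} (\<lambda>s. g s *\<^sub>R (D A (flow A b s) o\<^sub>L tangent A b s))"
proof -
  have c: "continuous_on ({0..T} \<times> UNIV)
      (\<lambda>(t, J::'a \<Rightarrow>\<^sub>L 'a). g t *\<^sub>R (D A (flow A b t) o\<^sub>L J))"
    unfolding case_prod_beta
    by (intro continuous_on_scaleR continuous_on_compose2[OF g_cont continuous_on_fst]
        bounded_bilinear.continuous_on[OF bounded_bilinear_blinfun_compose]
        continuous_on_compose2[OF D_flow_cont continuous_on_fst] continuous_on_snd continuous_on_id)
      auto
  have l: "norm (g t *\<^sub>R (D A (flow A b t) o\<^sub>L x) - g t *\<^sub>R (D A (flow A b t) o\<^sub>L y))
      \<le> C * norm A * norm (x - y)" if "t \<in> {0..T}" for t and x y :: "'a \<Rightarrow>\<^sub>L 'a"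
    unfolding scaleR_right_diff_distrib[symmetric]
      bounded_bilinear.diff_right[OF bounded_bilinear_blinfun_compose, symmetric]
    by (intro g_mult that order_trans[OF norm_blinfun_compose] mult_right_mono D_bound) simp
  have "continuous_on {0..T} (tangent A b) \<and>
    (\<forall>t\<in>{0..T}. tangent A b t =
      id_blinfun + integral {0..t} (\<lambda>s. g s *\<^sub>R (D A (flow A b s) o\<^sub>L tangent A b s)))"
    unfolding tangent_def using picard_exists[OF small'(3,2,1) c l] by (rule someI_ex)
  then show "continuous_on {0..T} (tangent A b)"
    "t \<in> {0..T} \<Longrightarrow> tangent A b t =
      id_blinfun + integral {0..t} (\<lambda>s. g s *\<^sub>R (D A (flow A b s) o\<^sub>L tangent A b s))"
    by blast+
qed

lemma tangent_rhs_cont: "continuous_on {0..T} (\<lambda>s. g s *\<^sub>R (D A (flow A b s) o\<^sub>L tangent A b s))"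
  by (intro continuous_on_scaleR g_cont D_flow_cont tangent(1)
      bounded_bilinear.continuous_on[OF bounded_bilinear_blinfun_compose])

lemma flow_0: "flow A b 0 = b"
  using flow(2)[of 0 b] T by simp

lemma tangent_0: "tangent A b 0 = id_blinfun"
  using tangent(2)[of 0 b] T by simp

lemma flow_has_vector_derivative:
  "t \<in> {0..T} \<Longrightarrow> (flow A b has_vector_derivative g t *\<^sub>R v A (flow A b t)) (at t within {0..T})"
  by (rule integral_eq_has_vector_derivative[OF flow_rhs_cont flow(2)])

lemma tangent_has_vector_derivative:
  "t \<in> {0..T} \<Longrightarrow> (tangent A b has_vector_derivative
    g t *\<^sub>R (D A (flow A b t) o\<^sub>L tangent A b t)) (at t within {0..T})"
  by (rule integral_eq_has_vector_derivative[OF tangent_rhs_cont tangent(2)])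

lemma flow_lipschitz:
  assumes t: "t \<in> {0..T}"
  shows "norm (flow A b t - flow A c t) \<le> 2 * norm (b - c)"
proof -
  have "norm (flow A b t - flow A c t) \<le> 2 * (norm (b - c) + 0 * T)"
  proof (rule short_time_gronwall[OF small'(2,1) _ _ _ _ t])
    show "flow A b t - flow A c t = (b - c) +
        integral {0..t} (\<lambda>s. g s *\<^sub>R v A (flow A b s) - g s *\<^sub>R v A (flow A c s))"
      if "t \<in> {0..T}" for t
      by (rule diff_integral_eqs[OF flow_rhs_cont flow_rhs_cont that]) (rule flow(2)[OF that])+
    show "norm (g s *\<^sub>R v A (flow A b s) - g s *\<^sub>R v A (flow A c s))
        \<le> C * norm A * norm (flow A b s - flow A c s) + 0" if "s \<in> {0..T}" for s
      unfolding scaleR_right_diff_distrib[symmetric] add_0_right by (intro g_mult that v_lip)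
  qed (intro continuous_intros flow_rhs_cont flow(1))+
  then show ?thesis by simp
qed

lemma tangent_bound:
  assumes t: "t \<in> {0..T}"
  shows "norm (tangent A b t) \<le> 2"
proof -
  have "norm (tangent A b t) \<le> 2 * (norm (id_blinfun :: 'a \<Rightarrow>\<^sub>L 'a) + 0 * T)"
  proof (rule short_time_gronwall[OF small'(2,1) tangent(1) tangent_rhs_cont tangent(2) _ t])
    show "norm (g s *\<^sub>R (D A (flow A b s) o\<^sub>L tangent A b s)) \<le> C * norm A * norm (tangent A b s) + 0"
      if "s \<in> {0..T}" for s
      unfolding add_0_right
      by (intro g_mult that order_trans[OF norm_blinfun_compose] mult_right_mono D_bound) simp
  qed
  also have "\<dots> \<le> 2" using norm_blinfun_id_le by simp
  finally show ?thesis .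
qed

text \<open>The error X(c) - X(b) - J(c - b) vanishes at time 0 and solves the linearized equation,
  forced by the Taylor remainder of \<open>v A\<close>. By \<open>flow_lipschitz\<close> the
  remainder is at most 4 C |A| |c - b|^2, and absorption doubles its integral; hence the 8.\<close>

lemma flow_has_derivative: "((\<lambda>b. flow A b T) has_derivative tangent A b T) (at b)"
proof (rule has_derivative_quadratic[where M = "8 * (C * norm A) * T"])
  fix c
  have Jc: "continuous_on {0..T} (\<lambda>s. tangent A b s (c - b))"
    by (intro bounded_bilinear.continuous_on[OF bounded_bilinear_blinfun_apply] tangent(1)
        continuous_on_const)
  have Jr: "continuous_on {0..T} (\<lambda>s. g s *\<^sub>R D A (flow A b s) (tangent A b s (c - b)))"
    by (intro continuous_on_scaleR g_cont bounded_bilinear.continuous_on[OF bounded_bilinear_blinfun_apply]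
        D_flow_cont Jc)
  have J: "tangent A b t (c - b) =
      (c - b) + integral {0..t} (\<lambda>s. g s *\<^sub>R D A (flow A b s) (tangent A b s (c - b)))"
    if "t \<in> {0..T}" for t
  proof -
    have i: "(\<lambda>s. g s *\<^sub>R (D A (flow A b s) o\<^sub>L tangent A b s)) integrable_on {0..t}"
      by (rule integrable_continuous_interval)
        (rule continuous_on_subset[OF tangent_rhs_cont], use that in auto)
    show ?thesis
      using integral_linear[OF i blinfun.bounded_linear_left[of "c - b"]]
      by (subst tangent(2)[OF that]) (simp add: o_def blinfun.add_left blinfun.scaleR_left)
  qed
  have "norm (flow A c T - flow A b T - tangent A b T (c - b))
      \<le> 2 * (norm (c - b - (c - b)) + (4 * (C * norm A) * (norm (c - b))\<^sup>2) * T)"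
  proof (rule short_time_gronwall[OF small'(2,1),
        where w = "\<lambda>t. flow A c t - flow A b t - tangent A b t (c - b)"])
    show "T \<in> {0..T}" using T by simp
    show "flow A c t - flow A b t - tangent A b t (c - b) = (c - b - (c - b)) + integral {0..t} (\<lambda>s.
        (g s *\<^sub>R v A (flow A c s) - g s *\<^sub>R v A (flow A b s)) -
        g s *\<^sub>R D A (flow A b s) (tangent A b s (c - b)))"
      if "t \<in> {0..T}" for t
      by (rule diff_integral_eqs[OF _ Jr that _ J[OF that]], intro continuous_intros flow_rhs_cont,
          rule diff_integral_eqs[OF flow_rhs_cont flow_rhs_cont that])
        (rule flow(2)[OF that])+
    show "norm (g s *\<^sub>R v A (flow A c s) - g s *\<^sub>R v A (flow A b s) -
        g s *\<^sub>R D A (flow A b s) (tangent A b s (c - b)))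
        \<le> C * norm A * norm (flow A c s - flow A b s - tangent A b s (c - b)) +
          4 * (C * norm A) * (norm (c - b))\<^sup>2"
      if s: "s \<in> {0..T}" for s
      unfolding scaleR_right_diff_distrib[symmetric]
    proof (rule g_mult[OF s])
      let ?x = "flow A c s" and ?y = "flow A b s"
      have eq: "v A ?x - v A ?y - D A ?y (tangent A b s (c - b)) =
          D A ?y (?x - ?y - tangent A b s (c - b)) + (v A ?x - v A ?y - D A ?y (?x - ?y))"
        by (simp add: blinfun.diff_right)
      have "norm (v A ?x - v A ?y - D A ?y (?x - ?y)) \<le> 4 * (C * norm A) * (norm (c - b))\<^sup>2"
      proof -
        have "(norm (?x - ?y))\<^sup>2 \<le> (2 * norm (c - b))\<^sup>2"
          by (rule power_mono[OF flow_lipschitz[OF s]]) simp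
        then have "C * norm A * (norm (?x - ?y))\<^sup>2 \<le> C * norm A * (2 * norm (c - b))\<^sup>2"
          by (rule mult_left_mono[OF _ small'(2)])
        then show ?thesis using v_taylor[of A ?x ?y] by (simp add: power_mult_distrib)
      qed
      moreover have "norm (D A ?y (?x - ?y - tangent A b s (c - b)))
          \<le> C * norm A * norm (?x - ?y - tangent A b s (c - b))"
        by (intro order_trans[OF norm_blinfun] mult_right_mono D_bound) simp
      ultimately show "norm (v A ?x - v A ?y - D A ?y (tangent A b s (c - b)))
          \<le> C * norm A * norm (?x - ?y - tangent A b s (c - b)) + 4 * (C * norm A) * (norm (c - b))\<^sup>2"
        unfolding eq by (intro order_trans[OF norm_triangle_ineq add_mono])
    qed
  qed (intro continuous_intros flow_rhs_cont flow(1) Jc Jr)+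
  then show "norm (flow A c T - flow A b T - tangent A b T (c - b))
      \<le> 8 * (C * norm A) * T * (norm (c - b))\<^sup>2"
    by (simp add: mult_ac)
qed (rule blinfun.bounded_linear_right)

text \<open>The integrand is frozen at the starting point and at the identity. With K = C |A|, the
  trajectory moves by at most K T and the tangent by at most 2 K T, so the two replacements cost K
  (K T) 2 and K (2 K T). Their sum 4 K^2 T is integrated over [0,T].\<close>

lemma tangent_expansion:
  "norm (tangent A b T - id_blinfun - integral {0..T} g *\<^sub>R D A b)
    \<le> 4 * C\<^sup>2 * T\<^sup>2 * (norm A)\<^sup>2"
proof -
  let ?K = "C * norm A"
  have TT: "T \<in> {0..T}" using T by simp
  have X: "norm (flow A b s - b) \<le> ?K * T" if "s \<in> {0..T}" for s
    using norm_integral_le_const[OF flow_rhs_cont that g_mult[OF _ v_bound]]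
    by (simp add: flow(2)[OF that])
  have J: "norm (tangent A b s - id_blinfun) \<le> 2 * ?K * T" if "s \<in> {0..T}" for s
  proof -
    have "norm (D A (flow A b r) o\<^sub>L tangent A b r) \<le> 2 * ?K" if "r \<in> {0..T}" for r
      using order_trans[OF norm_blinfun_compose
          mult_mono[OF D_bound[of A "flow A b r"] tangent_bound[OF that, of b]]] small'(2) by (simp add: mult_ac)
    from norm_integral_le_const[OF tangent_rhs_cont \<open>s \<in> _\<close> g_mult[OF _ this]]
    show ?thesis by (simp add: tangent(2)[OF that])
  qed
  have gi: "(\<lambda>s. g s *\<^sub>R D A b) integrable_on {0..T}"
    by (intro integrable_continuous_interval continuous_on_scaleR g_cont continuous_on_const)
  have "tangent A b T - id_blinfun - integral {0..T} g *\<^sub>R D A b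
      = integral {0..T} (\<lambda>s. g s *\<^sub>R (D A (flow A b s) o\<^sub>L tangent A b s) - g s *\<^sub>R D A b)"
  proof -
    have "integral {0..T} (\<lambda>s. g s *\<^sub>R D A b) = integral {0..T} g *\<^sub>R D A b"
      by (rule integral_unique[OF has_integral_scaleR_left[OF integrable_integral]])
        (intro integrable_continuous_interval g_cont)
    then show ?thesis
      using integral_diff[OF integrable_continuous_interval[OF tangent_rhs_cont] gi]
      by (simp add: tangent(2)[OF TT])
  qed
  moreover have "norm \<dots> \<le> (4 * ?K\<^sup>2 * T) * T"
  proof (rule norm_integral_le_const[OF _ TT])
    show "continuous_on {0..T} (\<lambda>s. g s *\<^sub>R (D A (flow A b s) o\<^sub>L tangent A b s) - g s *\<^sub>R D A b)"
      by (intro continuous_on_diff tangent_rhs_cont continuous_on_scaleR g_cont continuous_on_const)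
    fix s assume s: "s \<in> {0..T}"
    have "(D A (flow A b s) o\<^sub>L tangent A b s) - D A b =
        ((D A (flow A b s) - D A b) o\<^sub>L tangent A b s) + (D A b o\<^sub>L (tangent A b s - id_blinfun))"
      by (rule blinfun_eqI) (simp add: blinfun.diff_left blinfun.diff_right blinfun.add_left)
    moreover have "norm ((D A (flow A b s) - D A b) o\<^sub>L tangent A b s) \<le> (?K * (?K * T)) * 2"
      by (intro order_trans[OF norm_blinfun_compose] mult_mono tangent_bound s
          order_trans[OF D_lip] mult_left_mono X small' mult_nonneg_nonneg) auto
    moreover have "norm (D A b o\<^sub>L (tangent A b s - id_blinfun)) \<le> ?K * (2 * ?K * T)"
      by (intro order_trans[OF norm_blinfun_compose] mult_mono J s D_bound small') auto
    ultimately have "norm ((D A (flow A b s) o\<^sub>L tangent A b s) - D A b) \<le> 4 * ?K\<^sup>2 * T"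
      using norm_triangle_ineq[of "(D A (flow A b s) - D A b) o\<^sub>L tangent A b s"
          "D A b o\<^sub>L (tangent A b s - id_blinfun)"]
      by (simp add: power2_eq_square)
    then show "norm (g s *\<^sub>R (D A (flow A b s) o\<^sub>L tangent A b s) - g s *\<^sub>R D A b) \<le> 4 * ?K\<^sup>2 * T"
      unfolding scaleR_right_diff_distrib[symmetric] by (rule g_mult[OF s])
  qed
  ultimately show ?thesis by (simp add: power2_eq_square mult_ac)
qed

end

lemma flow_param:
  assumes A: "small A" and B: "small B" and t: "t \<in> {0..T}"
  shows "norm (flow A b t - flow B b t) \<le> 2 * C * T * norm (A - B)"
proof -
  have "norm (flow A b t - flow B b t) \<le> 2 * (norm (b - b) + (C * norm (A - B)) * T)"
  proof (rule short_time_gronwall[OF small'(2,1)[OF A] _ _ _ _ t])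
    show "flow A b t - flow B b t = (b - b) +
        integral {0..t} (\<lambda>s. g s *\<^sub>R v A (flow A b s) - g s *\<^sub>R v B (flow B b s))"
      if "t \<in> {0..T}" for t
      by (rule diff_integral_eqs[OF flow_rhs_cont[OF A] flow_rhs_cont[OF B] that
            flow(2)[OF A that] flow(2)[OF B that]])
    show "norm (g s *\<^sub>R v A (flow A b s) - g s *\<^sub>R v B (flow B b s))
        \<le> C * norm A * norm (flow A b s - flow B b s) + C * norm (A - B)" if "s \<in> {0..T}" for s
      unfolding scaleR_right_diff_distrib[symmetric]
    proof (rule g_mult[OF that])
      show "norm (v A (flow A b s) - v B (flow B b s))
          \<le> C * norm A * norm (flow A b s - flow B b s) + C * norm (A - B)"
        using v_lip[of A "flow A b s" "flow B b s"] v_param[of A "flow B b s" B]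
          norm_triangle_ineq[of "v A (flow A b s) - v A (flow B b s)" "v A (flow B b s) - v B (flow B b s)"]
        by simp
    qed
  qed (intro continuous_on_diff flow_rhs_cont flow(1) A B)+
  then show ?thesis by (simp add: mult_ac)
qed

text \<open>Supplies the continuity in \<open>A\<close> that Brouwer's theorem requires.\<close>

lemma tangent_param:
  assumes A: "small A" and B: "small B" and t: "t \<in> {0..T}"
  shows "norm (tangent A b t - tangent B b t) \<le> 8 * C * T * norm (A - B)"
proof -
  let ?d = "4 * C * norm (A - B)"
  have "norm (tangent A b t - tangent B b t) \<le> 2 * (norm (id_blinfun - id_blinfun :: 'a \<Rightarrow>\<^sub>L 'a) + ?d * T)"
  proof (rule short_time_gronwall[OF small'(2,1)[OF A] _ _ _ _ t])
    show "tangent A b t - tangent B b t = (id_blinfun - id_blinfun) +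
        integral {0..t} (\<lambda>s. g s *\<^sub>R (D A (flow A b s) o\<^sub>L tangent A b s) -
          g s *\<^sub>R (D B (flow B b s) o\<^sub>L tangent B b s))"
      if "t \<in> {0..T}" for t
      by (rule diff_integral_eqs[OF tangent_rhs_cont[OF A] tangent_rhs_cont[OF B] that
            tangent(2)[OF A that] tangent(2)[OF B that]])
    show "norm (g s *\<^sub>R (D A (flow A b s) o\<^sub>L tangent A b s) -
          g s *\<^sub>R (D B (flow B b s) o\<^sub>L tangent B b s))
        \<le> C * norm A * norm (tangent A b s - tangent B b s) + ?d" if s: "s \<in> {0..T}" for s
      unfolding scaleR_right_diff_distrib[symmetric]
    proof (rule g_mult[OF s])
      let ?x = "flow A b s" and ?y = "flow B b s" and ?J = "tangent A b s" and ?K = "tangent B b s"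
      have eq: "(D A ?x o\<^sub>L ?J) - (D B ?y o\<^sub>L ?K) = (D A ?x o\<^sub>L (?J - ?K)) + ((D A ?x - D B ?y) o\<^sub>L ?K)"
        by (rule blinfun_eqI) (simp add: blinfun.diff_left blinfun.diff_right blinfun.add_left)
      have "norm (D A ?x o\<^sub>L (?J - ?K)) \<le> C * norm A * norm (?J - ?K)"
        by (intro order_trans[OF norm_blinfun_compose] mult_right_mono D_bound) simp
      moreover have "norm ((D A ?x - D B ?y) o\<^sub>L ?K) \<le> (2 * C * norm (A - B)) * 2"
      proof (intro order_trans[OF norm_blinfun_compose] mult_mono tangent_bound B s)
        \<comment> \<open>Smallness of \<open>A\<close> turns the displacement of the trajectories
          into another C |A - B|. Hence 2 C |A - B| for the change of \<open>D\<close>, and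
          \<open>?d\<close> after multiplication by the bound 2 on the tangent.\<close>
        have "C * norm A * norm (?x - ?y) \<le> C * norm A * (2 * C * T * norm (A - B))"
          by (intro mult_left_mono flow_param A B s small'(2))
        also have "\<dots> = (C * norm A * T) * (2 * C * norm (A - B))"
          by (simp add: mult_ac)
        also have "\<dots> \<le> 1/2 * (2 * C * norm (A - B))"
          by (intro mult_right_mono small'(1) A) (use C in auto)
        finally have "C * norm A * norm (?x - ?y) \<le> C * norm (A - B)" by simp
        then show "norm (D A ?x - D B ?y) \<le> 2 * C * norm (A - B)"
          using D_lip[of A ?x ?y] D_param[of A ?y B]
            norm_triangle_ineq[of "D A ?x - D A ?y" "D A ?y - D B ?y"] by simp
      qed (use C in auto)
      ultimately show "norm ((D A ?x o\<^sub>L ?J) - (D B ?y o\<^sub>L ?K)) \<le> C * norm A * norm (?J - ?K) + ?d"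
        unfolding eq
        using norm_triangle_ineq[of "D A ?x o\<^sub>L (?J - ?K)" "(D A ?x - D B ?y) o\<^sub>L ?K"]
        by linarith
    qed
  qed (intro continuous_on_diff tangent_rhs_cont tangent(1) A B)+
  then show ?thesis by (simp add: mult_ac)
qed

lemma tangent_cont: "continuous_on {A. small A} (\<lambda>A. tangent A b T)"
proof (rule lipschitz_on_continuous_on)
  show "(8 * C * T)-lipschitz_on {A. small A} (\<lambda>A. tangent A b T)"
    using tangent_param[of _ _ T b] C T by (intro lipschitz_onI) (auto simp: dist_norm)
qed

end

section \<open>Analyticity of exponential polynomials\<close>

lemma real_analytic_on_add:
  assumes "f real_analytic_on S" "g real_analytic_on S"
  shows "(\<lambda>x. f x + g x) real_analytic_on S"
  unfolding real_analytic_on_def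
proof
  fix x assume "x \<in> S"
  then obtain r c r' c' where r: "r > 0" "r' > 0"
    and f: "\<And>y. y \<in> ball x r \<Longrightarrow>
        ((\<lambda>\<alpha>. (\<Prod>b\<in>Basis. ((y - x) \<bullet> b) ^ \<alpha> b) *\<^sub>R c \<alpha>) has_sum f y) (Basis \<rightarrow>\<^sub>E UNIV)"
    and g: "\<And>y. y \<in> ball x r' \<Longrightarrow>
        ((\<lambda>\<alpha>. (\<Prod>b\<in>Basis. ((y - x) \<bullet> b) ^ \<alpha> b) *\<^sub>R c' \<alpha>) has_sum g y) (Basis \<rightarrow>\<^sub>E UNIV)"
    using assms unfolding real_analytic_on_def by meson
  show "\<exists>r>0. \<exists>c. \<forall>y\<in>ball x r.
      ((\<lambda>\<alpha>. (\<Prod>b\<in>Basis. ((y - x) \<bullet> b) ^ \<alpha> b) *\<^sub>R c \<alpha>) has_sum (f y + g y)) (Basis \<rightarrow>\<^sub>E UNIV)"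
  proof (intro exI[of _ "min r r'"] conjI exI[of _ "\<lambda>\<alpha>. c \<alpha> + c' \<alpha>"] ballI)
    fix y assume "y \<in> ball x (min r r')"
    then show "((\<lambda>\<alpha>. (\<Prod>b\<in>Basis. ((y - x) \<bullet> b) ^ \<alpha> b) *\<^sub>R (c \<alpha> + c' \<alpha>)) has_sum (f y + g y))
        (Basis \<rightarrow>\<^sub>E UNIV)"
      unfolding scaleR_add_right by (intro has_sum_add f g) auto
  qed (use r in simp)
qed

lemma real_analytic_on_bounded_linear:
  assumes "bounded_linear h" "f real_analytic_on S"
  shows "(\<lambda>x. h (f x)) real_analytic_on S"
  unfolding real_analytic_on_def
proof
  fix x assume "x \<in> S"
  then obtain r c where r: "r > 0"
    and f: "\<And>y. y \<in> ball x r \<Longrightarrow>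
        ((\<lambda>\<alpha>. (\<Prod>b\<in>Basis. ((y - x) \<bullet> b) ^ \<alpha> b) *\<^sub>R c \<alpha>) has_sum f y) (Basis \<rightarrow>\<^sub>E UNIV)"
    using assms unfolding real_analytic_on_def by meson
  show "\<exists>r>0. \<exists>c. \<forall>y\<in>ball x r.
      ((\<lambda>\<alpha>. (\<Prod>b\<in>Basis. ((y - x) \<bullet> b) ^ \<alpha> b) *\<^sub>R c \<alpha>) has_sum h (f y)) (Basis \<rightarrow>\<^sub>E UNIV)"
  proof (intro exI[of _ r] conjI exI[of _ "\<lambda>\<alpha>. h (c \<alpha>)"] ballI)
    fix y assume "y \<in> ball x r"
    from has_sum_bounded_linear[OF assms(1) f[OF this]]
    show "((\<lambda>\<alpha>. (\<Prod>b\<in>Basis. ((y - x) \<bullet> b) ^ \<alpha> b) *\<^sub>R h (c \<alpha>)) has_sum h (f y)) (Basis \<rightarrow>\<^sub>E UNIV)"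
      by (simp add: linear_cmul bounded_linear.linear[OF assms(1)])
  qed (use r in simp)
qed

lemma real_analytic_on_sum:
  assumes "finite I" "I \<noteq> {}" "\<And>i. i \<in> I \<Longrightarrow> f i real_analytic_on S"
  shows "(\<lambda>x. \<Sum>i\<in>I. f i x) real_analytic_on S"
  using assms
  by (induction rule: finite_ne_induct) (auto intro: real_analytic_on_add simp: eta_contract_eq)

text \<open>The product of the one-variable exponential series, written as one unconditional sum
  over multi-indices as \<open>real_analytic_on\<close> demands.\<close>

lemma has_sum_exp_multi:
  fixes z :: "'a \<Rightarrow> complex"
  assumes "finite B"
  shows "((\<lambda>\<alpha>. \<Prod>b\<in>B. z b ^ \<alpha> b /\<^sub>R fact (\<alpha> b)) has_sum exp (\<Sum>b\<in>B. z b)) (B \<rightarrow>\<^sub>E UNIV)"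
proof -
  let ?e = "\<lambda>b n. z b ^ n /\<^sub>R fact n"
  have s: "summable (\<lambda>n. norm (?e b n))" for b
    using summable_norm_exp[of "z b"] .
  have abs: "Infinite_Sum.abs_summable_on (?e b) UNIV" for b
    by (rule norm_summable_imp_summable_on) (use s in simp)
  \<comment> \<open>\<open>abs_summable_equivalent\<close> passes to the
    \<open>Infinite_Set_Sum\<close> notion, for which the product rule is used, and back.\<close>
  have "Infinite_Set_Sum.abs_summable_on (\<lambda>\<alpha>. \<Prod>b\<in>B. ?e b (\<alpha> b)) (B \<rightarrow>\<^sub>E UNIV)"
    by (rule abs_summable_on_prod_PiE[OF assms _ abs[unfolded abs_summable_equivalent]]) simp
  then have "(\<lambda>\<alpha>. \<Prod>b\<in>B. ?e b (\<alpha> b)) summable_on (B \<rightarrow>\<^sub>E UNIV)"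
    by (rule abs_summable_summable[OF iffD2[OF abs_summable_equivalent]])
  moreover have "infsum (\<lambda>\<alpha>. \<Prod>b\<in>B. ?e b (\<alpha> b)) (B \<rightarrow>\<^sub>E UNIV) = (\<Prod>b\<in>B. infsum (?e b) UNIV)"
    by (rule infsum_prod_PiE_abs[OF assms abs])
  moreover have "infsum (?e b) UNIV = exp (z b)" for b
    by (rule infsumI[OF norm_summable_imp_has_sum[OF s exp_converges]])
  ultimately show ?thesis
    using assms by (simp add: exp_sum has_sum_iff)
qed

text \<open>Factor out \<open>exp (L x)\<close> and expand \<open>L (y - x)\<close> in the basis.
  The series converges everywhere, so the radius 1 is arbitrary.\<close>

lemma exp_linear_real_analytic:
  fixes L :: "'a::euclidean_space \<Rightarrow> complex"
  assumes "bounded_linear L"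
  shows "(\<lambda>x. c * exp (L x)) real_analytic_on S"
  unfolding real_analytic_on_def
proof
  fix x :: 'a
  interpret L: bounded_linear L by fact
  show "\<exists>r>0. \<exists>d. \<forall>y\<in>ball x r.
      ((\<lambda>\<alpha>. (\<Prod>b\<in>Basis. ((y - x) \<bullet> b) ^ \<alpha> b) *\<^sub>R d \<alpha>) has_sum (c * exp (L y))) (Basis \<rightarrow>\<^sub>E UNIV)"
  proof (intro exI[of _ 1] conjI exI[of _ "\<lambda>\<alpha>. c * exp (L x) * (\<Prod>b\<in>Basis. L b ^ \<alpha> b /\<^sub>R fact (\<alpha> b))"] ballI)
    fix y
    have "L (y - x) = (\<Sum>b\<in>Basis. ((y - x) \<bullet> b) *\<^sub>R L b)"
      by (subst euclidean_representation[of "y - x", symmetric]) (simp only: L.sum L.scaleR)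
    moreover have "L y = L x + L (y - x)" by (simp add: L.diff)
    ultimately have e: "c * exp (L y) = c * exp (L x) * exp (\<Sum>b\<in>Basis. ((y - x) \<bullet> b) *\<^sub>R L b)"
      by (simp add: exp_add)
    show "((\<lambda>\<alpha>. (\<Prod>b\<in>Basis. ((y - x) \<bullet> b) ^ \<alpha> b) *\<^sub>R
        (c * exp (L x) * (\<Prod>b\<in>Basis. L b ^ \<alpha> b /\<^sub>R fact (\<alpha> b)))) has_sum (c * exp (L y))) (Basis \<rightarrow>\<^sub>E UNIV)"
      unfolding e
      using has_sum_cmult_right[OF has_sum_exp_multi[OF finite_Basis,
            of "\<lambda>b. ((y - x) \<bullet> b) *\<^sub>R L b"], of "c * exp (L x)"]
      by (simp add: scaleR_conv_of_real power_mult_distrib prod.distrib mult_ac)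
  qed simp
qed

text \<open>This class makes products harmless: two exponentials multiply to a third by adding the
  linear forms, so analyticity of products follows from sums alone and power series are never
  multiplied. Complex coefficients and exponents bring in sine and cosine.\<close>

inductive exp_poly :: "('a::euclidean_space \<Rightarrow> complex) \<Rightarrow> bool" where
  exp: "bounded_linear L \<Longrightarrow> exp_poly (\<lambda>x. c * exp (L x))"
| add: "exp_poly f \<Longrightarrow> exp_poly g \<Longrightarrow> exp_poly (\<lambda>x. f x + g x)"

lemma exp_poly_real_analytic: "exp_poly f \<Longrightarrow> f real_analytic_on S"
  by (induction rule: exp_poly.induct) (auto intro: real_analytic_on_add exp_linear_real_analytic)

lemma exp_poly_mult_exp:
  assumes "exp_poly f" "bounded_linear M"
  shows "exp_poly (\<lambda>x. f x * (d * exp (M x)))"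
  using assms(1)
proof induction
  case (exp L c)
  have "exp_poly (\<lambda>x. (c * d) * exp (L x + M x))"
    by (intro exp_poly.exp bounded_linear_add exp assms(2))
  then show ?case by (simp add: exp_add mult_ac)
qed (simp add: distrib_right exp_poly.add)

lemma exp_poly_mult:
  assumes "exp_poly f" "exp_poly g"
  shows "exp_poly (\<lambda>x. f x * g x)"
  using assms(2)
  by induction (auto simp: distrib_left intro: exp_poly_mult_exp exp_poly.add assms(1))

definition real_exp_poly :: "('a::euclidean_space \<Rightarrow> real) \<Rightarrow> bool" where
  "real_exp_poly f \<longleftrightarrow> exp_poly (\<lambda>x. complex_of_real (f x))"

lemma real_exp_poly_add: "real_exp_poly f \<Longrightarrow> real_exp_poly g \<Longrightarrow> real_exp_poly (\<lambda>x. f x + g x)"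
  by (simp add: real_exp_poly_def exp_poly.add)

lemma real_exp_poly_mult: "real_exp_poly f \<Longrightarrow> real_exp_poly g \<Longrightarrow> real_exp_poly (\<lambda>x. f x * g x)"
  by (simp add: real_exp_poly_def exp_poly_mult)

lemma real_exp_poly_const: "real_exp_poly (\<lambda>x. c)"
  using exp_poly.exp[OF bounded_linear_zero, of "complex_of_real c"] by (simp add: real_exp_poly_def)

lemma real_exp_poly_sum:
  "finite I \<Longrightarrow> (\<And>i. i \<in> I \<Longrightarrow> real_exp_poly (f i)) \<Longrightarrow> real_exp_poly (\<lambda>x. \<Sum>i\<in>I. f i x)"
  by (induction rule: finite_induct) (auto intro: real_exp_poly_add real_exp_poly_const)

lemma real_exp_poly_exp:
  assumes "bounded_linear l"
  shows "real_exp_poly (\<lambda>x. exp (l x))"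
  using exp_poly.exp[OF bounded_linear_compose[OF bounded_linear_of_real assms], of 1]
  by (simp add: real_exp_poly_def exp_of_real)

lemma real_exp_poly_cos:
  assumes "bounded_linear l"
  shows "real_exp_poly (\<lambda>x. cos (l x + c))"
proof -
  have e: "bounded_linear (\<lambda>x. z * complex_of_real (l x))" for z
    by (intro bounded_linear_const_mult bounded_linear_compose[OF bounded_linear_of_real assms])
  have "complex_of_real (cos (l x + c)) =
      exp (\<i> * c) / 2 * exp (\<i> * of_real (l x)) + exp (- \<i> * c) / 2 * exp (- \<i> * of_real (l x))" for x
  proof -
    have "complex_of_real (cos (l x + c)) =
        (exp (\<i> * of_real (l x) + \<i> * c) + exp (- \<i> * of_real (l x) + - \<i> * c)) / 2"
      by (simp only: cos_of_real[symmetric] cos_exp_eq) (simp add: algebra_simps)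
    then show ?thesis
      by (simp only: exp_add) (simp add: add_divide_distrib mult_ac)
  qed
  moreover have "exp_poly (\<lambda>x. exp (\<i> * c) / 2 * exp (\<i> * of_real (l x)) +
      exp (- \<i> * c) / 2 * exp (- \<i> * of_real (l x)))"
    by (intro exp_poly.add exp_poly.exp e)
  ultimately show ?thesis
    unfolding real_exp_poly_def by presburger
qed

lemma real_exp_poly_sin:
  assumes "bounded_linear l"
  shows "real_exp_poly (\<lambda>x. sin (l x + c))"
  using real_exp_poly_cos[OF assms, of "c - pi / 2"]
  by (simp add: cos_diff add_diff_eq)

lemma real_exp_poly_real_analytic: "real_exp_poly f \<Longrightarrow> f real_analytic_on S"
  using real_analytic_on_bounded_linear[OF bounded_linear_Re exp_poly_real_analytic]
  by (fastforce simp: real_exp_poly_def)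

lemma real_exp_poly_real_analytic_vec:
  fixes f :: "'a::euclidean_space \<Rightarrow> real^'n"
  assumes "\<And>i. real_exp_poly (\<lambda>x. f x $ i)"
  shows "f real_analytic_on S"
proof -
  have "(\<lambda>x. \<Sum>i\<in>UNIV. f x $ i *\<^sub>R (axis i 1 :: real^'n)) real_analytic_on S"
    by (intro real_analytic_on_sum real_analytic_on_bounded_linear[OF bounded_linear_scaleR_left]
        real_exp_poly_real_analytic assms) auto
  moreover have "(\<Sum>i\<in>UNIV. f x $ i *\<^sub>R (axis i 1 :: real^'n)) = f x" for x
    using basis_expansion[of "f x"] by (simp add: scalar_mult_eq_scaleR)
  ultimately show ?thesis by simp
qed

section \<open>Beltrami fields\<close>

text \<open>For \<open>k \<bullet> q = 0\<close> and \<open>k\<close> of length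
  \<open>l > 0\<close>, this is \<open>q\<close> turned by a right angle about
  \<open>k\<close>.\<close>

definition wave_cos :: "real \<Rightarrow> real^3 \<Rightarrow> real^3 \<Rightarrow> real^3" where
  "wave_cos l k q = (1 / l) *\<^sub>R cross3 k q"

text \<open>A circularly polarized wave with phase \<open>s\<close>, an eigenfield of curl with
  eigenvalue \<open>l\<close> under the conditions on \<open>k\<close> and \<open>q\<close>. As
  \<open>q\<close> multiplies the sine, the gradient at phase 0 is the rank-one matrix with entries
  q_i k_j, so amplitudes can be read off at the center \<open>a\<close>.\<close>

definition wave :: "real \<Rightarrow> real^3 \<Rightarrow> real^3 \<Rightarrow> real \<Rightarrow> real^3" where
  "wave l k q s = cos s *\<^sub>R wave_cos l k q + sin s *\<^sub>R q"

definition wave_deriv :: "real \<Rightarrow> real^3 \<Rightarrow> real^3 \<Rightarrow> real \<Rightarrow> real^3" where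
  "wave_deriv l k q s = cos s *\<^sub>R q - sin s *\<^sub>R wave_cos l k q"

definition beltrami :: "real \<Rightarrow> (real^3) set \<Rightarrow> (real^3 \<Rightarrow> real^3) \<Rightarrow> real^3 \<Rightarrow> real^3 \<Rightarrow> real^3" where
  "beltrami l K q a x = (\<Sum>k\<in>K. wave l k (q k) (k \<bullet> (x - a)))"

definition beltrami_deriv ::
  "real \<Rightarrow> (real^3) set \<Rightarrow> (real^3 \<Rightarrow> real^3) \<Rightarrow> real^3 \<Rightarrow> real^3 \<Rightarrow> real^3 \<Rightarrow> real^3" where
  "beltrami_deriv l K q a x h = (\<Sum>k\<in>K. (k \<bullet> h) *\<^sub>R wave_deriv l k (q k) (k \<bullet> (x - a)))"

lemma wave_scaleR: "wave l k (c *\<^sub>R q) s = c *\<^sub>R wave l k q s"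
  by (simp add: wave_def wave_cos_def cross_mult_right scaleR_add_right mult_ac)

lemma beltrami_scaleR: "beltrami l K (\<lambda>k. c *\<^sub>R q k) a x = c *\<^sub>R beltrami l K q a x"
  by (simp add: beltrami_def wave_scaleR scaleR_sum_right)

lemma wave_has_derivative:
  "((\<lambda>x. wave l k q (k \<bullet> (x - a))) has_derivative
    (\<lambda>h. (k \<bullet> h) *\<^sub>R wave_deriv l k q (k \<bullet> (x - a)))) (at x)"
  unfolding wave_def wave_deriv_def
  by (auto intro!: derivative_eq_intros simp: algebra_simps)

lemma wave_deriv_has_derivative:
  "((\<lambda>x. wave_deriv l k q (k \<bullet> (x - a))) has_derivative
    (\<lambda>h. - (k \<bullet> h) *\<^sub>R wave l k q (k \<bullet> (x - a)))) (at x)"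
  unfolding wave_def wave_deriv_def
  by (auto intro!: derivative_eq_intros simp: algebra_simps)

lemma beltrami_has_derivative:
  "(beltrami l K q a has_derivative beltrami_deriv l K q a x) (at x)"
  unfolding beltrami_def beltrami_deriv_def
  by (intro has_derivative_sum wave_has_derivative)

lemma partial_deriv_eq:
  "(f has_derivative f') (at x) \<Longrightarrow> partial_deriv i f x = f' (axis i 1)"
  unfolding partial_deriv_def by (metis frechet_derivative_at)

lemma partial_deriv_beltrami:
  "partial_deriv i (beltrami l K q a) x =
    (\<Sum>k\<in>K. (k $ i) *\<^sub>R wave_deriv l k (q k) (k \<bullet> (x - a)))"
  by (simp add: partial_deriv_eq[OF beltrami_has_derivative] beltrami_deriv_def inner_axis)

lemma partial_deriv_nth:
  assumes "(f has_derivative f') (at x)"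
  shows "partial_deriv i (\<lambda>y. f y $ j) x = f' (axis i 1) $ j"
  by (rule partial_deriv_eq[OF bounded_linear.has_derivative[OF bounded_linear_vec_nth assms]])

lemma laplacian_beltrami:
  assumes "\<And>k. k \<in> K \<Longrightarrow> k \<bullet> k = l\<^sup>2"
  shows "laplacian (beltrami l K q a) x = - l\<^sup>2 *\<^sub>R beltrami l K q a x"
proof -
  have "partial_deriv i (partial_deriv i (beltrami l K q a)) x =
      (\<Sum>k\<in>K. (k $ i) *\<^sub>R (- (k $ i) *\<^sub>R wave l k (q k) (k \<bullet> (x - a))))" for i
  proof -
    have "((\<lambda>x. \<Sum>k\<in>K. (k $ i) *\<^sub>R wave_deriv l k (q k) (k \<bullet> (x - a))) has_derivative
        (\<lambda>h. \<Sum>k\<in>K. (k $ i) *\<^sub>R (- (k \<bullet> h) *\<^sub>R wave l k (q k) (k \<bullet> (x - a))))) (at x)"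
      by (intro has_derivative_sum has_derivative_scaleR_right wave_deriv_has_derivative)
    from partial_deriv_eq[OF this, of i] show ?thesis
      unfolding partial_deriv_beltrami[abs_def] by (simp add: inner_axis)
  qed
  then have "laplacian (beltrami l K q a) x =
      (\<Sum>k\<in>K. \<Sum>i\<in>UNIV. - (k $ i * k $ i) *\<^sub>R wave l k (q k) (k \<bullet> (x - a)))"
    unfolding laplacian_def by (subst sum.swap) simp
  also have "\<dots> = (\<Sum>k\<in>K. - (k \<bullet> k) *\<^sub>R wave l k (q k) (k \<bullet> (x - a)))"
    by (simp add: inner_vec_def scaleR_sum_left sum_negf)
  also have "\<dots> = - l\<^sup>2 *\<^sub>R beltrami l K q a x"
    by (simp add: assms beltrami_def scaleR_sum_right sum_negf)
  finally show ?thesis .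
qed

lemma inner_wave_deriv:
  assumes "k \<bullet> q = 0"
  shows "k \<bullet> wave_deriv l k q s = 0"
  using assms by (simp add: wave_deriv_def wave_cos_def inner_diff_right dot_cross_self)

lemma trace_beltrami_deriv:
  assumes "\<And>k. k \<in> K \<Longrightarrow> k \<bullet> q k = 0"
  shows "(\<Sum>i\<in>UNIV. beltrami_deriv l K q a x (axis i 1) $ i) = 0"
proof -
  have "(\<Sum>i\<in>UNIV. beltrami_deriv l K q a x (axis i 1) $ i) =
      (\<Sum>k\<in>K. k \<bullet> wave_deriv l k (q k) (k \<bullet> (x - a)))"
    unfolding beltrami_deriv_def
    by (simp add: inner_axis sum.swap[of _ K]) (simp add: inner_vec_def)
  then show ?thesis by (simp add: assms inner_wave_deriv)
qed

lemma divergence_beltrami: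
  assumes "\<And>k. k \<in> K \<Longrightarrow> k \<bullet> q k = 0"
  shows "divergence (beltrami l K q a) x = 0"
  unfolding divergence_def partial_deriv_nth[OF beltrami_has_derivative]
  by (rule trace_beltrami_deriv[OF assms])

text \<open>This is curl v = l v for one wave: the curl of a function of the phase is
  \<open>k\<close> crossed with its phase derivative.\<close>

lemma cross_wave_deriv:
  assumes "k \<bullet> q = 0" "k \<bullet> k = l\<^sup>2" "l \<noteq> 0"
  shows "cross3 (wave_deriv l k q s) k = - l *\<^sub>R wave l k q s"
proof -
  have "cross3 q k = - l *\<^sub>R wave_cos l k q"
    using assms(3) cross_skew[of q k] by (simp add: wave_cos_def)
  moreover have "cross3 (wave_cos l k q) k = l *\<^sub>R q"
  proof -
    have "cross3 (cross3 k q) k = (k \<bullet> k) *\<^sub>R q - (k \<bullet> q) *\<^sub>R k"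
      by (simp add: cross3_simps forall_3)
    then show ?thesis
      using assms by (simp add: wave_cos_def cross_mult_left power2_eq_square)
  qed
  ultimately show ?thesis
    by (simp add: wave_deriv_def wave_def Cross3.left_diff_distrib cross_mult_left algebra_simps)
qed

text \<open>In the Lamb form \<open>(v \<cdot> \<nabla>) v = \<nabla> \<bar>v\<bar>\<^sup>2 / 2 + curl v \<times> v\<close> the last term vanishes because
  \<open>curl v = l v\<close>.\<close>

lemma beltrami_steady_euler:
  assumes "\<And>k. k \<in> K \<Longrightarrow> k \<bullet> q k = 0" "\<And>k. k \<in> K \<Longrightarrow> k \<bullet> k = l\<^sup>2" "l \<noteq> 0"
  shows "advection (beltrami l K q a) (beltrami l K q a) x
    + gradient (\<lambda>y. - (beltrami l K q a y \<bullet> beltrami l K q a y) / 2) x = 0"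
proof -
  let ?v = "beltrami l K q a" and ?R = "\<lambda>k. wave_deriv l k (q k) (k \<bullet> (x - a))"
  have "advection ?v ?v x = (\<Sum>k\<in>K. \<Sum>j\<in>UNIV. (k $ j * ?v x $ j) *\<^sub>R ?R k)"
    unfolding advection_def partial_deriv_beltrami
    by (simp add: scaleR_sum_right sum.swap[of _ K] mult.commute)
  also have "\<dots> = (\<Sum>k\<in>K. (k \<bullet> ?v x) *\<^sub>R ?R k)"
    by (simp add: inner_vec_def scaleR_sum_left)
  finally have adv: "advection ?v ?v x = (\<Sum>k\<in>K. (k \<bullet> ?v x) *\<^sub>R ?R k)" .
  have "((\<lambda>y. - (?v y \<bullet> ?v y) / 2) has_derivative (\<lambda>h. - (?v x \<bullet> beltrami_deriv l K q a x h))) (at x)"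
    by (auto intro!: derivative_eq_intros beltrami_has_derivative simp: inner_commute)
  from partial_deriv_eq[OF this]
  have "gradient (\<lambda>y. - (?v y \<bullet> ?v y) / 2) x = - (\<Sum>k\<in>K. (?v x \<bullet> ?R k) *\<^sub>R k)"
    by (simp add: gradient_def beltrami_deriv_def vec_eq_iff inner_sum_right inner_axis mult.commute)
  then have "advection ?v ?v x + gradient (\<lambda>y. - (?v y \<bullet> ?v y) / 2) x =
      (\<Sum>k\<in>K. (k \<bullet> ?v x) *\<^sub>R ?R k - (?v x \<bullet> ?R k) *\<^sub>R k)"
    by (simp add: adv sum_subtractf)
  \<comment> \<open>The triple product identity a x (b x c) = (a.c) b - (a.b) c.\<close>
  also have "\<dots> = (\<Sum>k\<in>K. cross3 (?v x) (cross3 (?R k) k))"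
    by (intro sum.cong refl) (simp add: cross3_simps forall_3)
  also have "\<dots> = (\<Sum>k\<in>K. - l *\<^sub>R cross3 (?v x) (wave l k (q k) (k \<bullet> (x - a))))"
    by (intro sum.cong refl) (simp add: cross_wave_deriv assms cross_mult_right)
  also have "\<dots> = - l *\<^sub>R cross3 (?v x) (?v x)"
  proof -
    interpret c: linear "cross3 (?v x)"
      using bilinear_cross by (simp add: bilinear_def)
    show ?thesis
      by (simp only: scaleR_sum_right[symmetric] c.sum[symmetric] beltrami_def[symmetric])
  qed
  finally show ?thesis by simp
qed

lemma torus_periodic_beltrami:
  assumes "\<And>k i. k \<in> K \<Longrightarrow> k $ i \<in> \<int>"
  shows "torus_periodic (beltrami l K q a)"
  unfolding torus_periodic_def
proof (intro allI)
  fix x i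
  have "wave l k (q k) (k \<bullet> (x + axis i (2 * pi) - a)) = wave l k (q k) (k \<bullet> (x - a))" if k: "k \<in> K" for k
  proof -
    obtain n where n: "k $ i = of_int n" using assms[OF k] by (auto elim: Ints_cases)
    have "k \<bullet> (x + axis i (2 * pi) - a) = k \<bullet> (x - a) + 2 * pi * of_int n"
      by (simp add: inner_add_right inner_diff_right inner_axis n)
    then show ?thesis
      by (simp add: wave_def sin_add cos_add)
  qed
  then show "beltrami l K q a (x + axis i (2 * pi)) = beltrami l K q a x"
    by (simp add: beltrami_def)
qed

text \<open>The pressure cancels the advection term at each time separately. What remains is the
  heat equation, and on an eigenfield of the Laplacian with eigenvalue - l^2 it is solved by the
  decay factor; for \<open>\<nu> = 0\<close> the flow is steady.\<close>

lemma beltrami_analytic_periodic_solution: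
  fixes a :: "real^3" and \<nu> :: real
  assumes "0 < T" and K: "finite K" "l \<noteq> 0"
    "\<And>k. k \<in> K \<Longrightarrow> k \<bullet> q k = 0" "\<And>k. k \<in> K \<Longrightarrow> k \<bullet> k = l\<^sup>2" "\<And>k i. k \<in> K \<Longrightarrow> k $ i \<in> \<int>"
  defines "u \<equiv> \<lambda>t x. exp (- (\<nu> * l\<^sup>2) * t) *\<^sub>R beltrami l K q a x"
  shows "analytic_periodic_solution \<nu> T u (\<lambda>t x. - (u t x \<bullet> u t x) / 2)"
proof -
  define g where "g t = exp (- (\<nu> * l\<^sup>2) * t)" for t
  \<comment> \<open>Absorbing the decay into the amplitudes makes the spatial lemmas apply at each
    fixed time.\<close>
  have u: "u t = beltrami l K (\<lambda>k. g t *\<^sub>R q k) a" for t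
    by (simp add: u_def g_def beltrami_scaleR fun_eq_iff)
  have u_poly: "real_exp_poly (\<lambda>z. u (fst z) (snd z) $ i)" for i
  proof -
    have "real_exp_poly (\<lambda>z::real \<times> (real^3). exp (- (\<nu> * l\<^sup>2) * fst z) *
        (\<Sum>k\<in>K. cos (k \<bullet> snd z + (- (k \<bullet> a))) * (wave_cos l k (q k) $ i)
          + sin (k \<bullet> snd z + (- (k \<bullet> a))) * (q k $ i)))"
      by (intro real_exp_poly_mult real_exp_poly_exp real_exp_poly_sum K real_exp_poly_add
          real_exp_poly_cos real_exp_poly_sin real_exp_poly_const bounded_linear_const_mult
          bounded_linear_fst bounded_linear_inner_right_comp bounded_linear_snd)
    then show ?thesis
      by (simp add: u_def beltrami_def wave_def inner_diff_right)
  qed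
  have "(\<lambda>z. u (fst z) (snd z)) real_analytic_on {0..T} \<times> UNIV"
    by (rule real_exp_poly_real_analytic_vec[OF u_poly])
  moreover have "(\<lambda>z. - (u (fst z) (snd z) \<bullet> u (fst z) (snd z)) / 2) real_analytic_on {0..T} \<times> UNIV"
  proof (rule real_exp_poly_real_analytic)
    have "real_exp_poly (\<lambda>z. (-1/2) * (\<Sum>i\<in>UNIV. u (fst z) (snd z) $ i * u (fst z) (snd z) $ i))"
      by (intro real_exp_poly_mult real_exp_poly_const real_exp_poly_sum u_poly) simp
    then show "real_exp_poly (\<lambda>z. - (u (fst z) (snd z) \<bullet> u (fst z) (snd z)) / 2)"
      by (simp add: inner_vec_def)
  qed
  moreover have per: "torus_periodic (u t)" for t
    unfolding u by (rule torus_periodic_beltrami[OF K(5)])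
  moreover have "torus_periodic (\<lambda>x. - (u t x \<bullet> u t x) / 2)" for t
    using per[of t] by (simp add: torus_periodic_def)
  moreover have "vector_derivative (\<lambda>s. u s x) (at t within {0..T}) + advection (u t) (u t) x
      + gradient (\<lambda>x. - (u t x \<bullet> u t x) / 2) x = \<nu> *\<^sub>R laplacian (u t) x"
    if "t \<in> {0..T}" for t x
  proof -
    have "((\<lambda>s. u s x) has_vector_derivative - (\<nu> * l\<^sup>2) *\<^sub>R u t x) (at t)"
      unfolding u_def has_vector_derivative_def
      by (auto intro!: derivative_eq_intros simp: algebra_simps)
    then have "vector_derivative (\<lambda>s. u s x) (at t within {0..T}) = - (\<nu> * l\<^sup>2) *\<^sub>R u t x"
      using that assms(1) by (intro vector_derivative_at_within_ivl) auto
    moreover have "advection (u t) (u t) x + gradient (\<lambda>x. - (u t x \<bullet> u t x) / 2) x = 0"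
      unfolding u by (rule beltrami_steady_euler) (use K in auto)
    moreover have "laplacian (u t) x = - l\<^sup>2 *\<^sub>R u t x"
      unfolding u by (rule laplacian_beltrami) (use K in auto)
    ultimately show ?thesis by (simp add: add.assoc)
  qed
  moreover have "divergence (u t) x = 0" for t x
    unfolding u by (rule divergence_beltrami) (use K in auto)
  ultimately show ?thesis
    unfolding analytic_periodic_solution_def by (simp add: case_prod_beta')
qed

section \<open>Estimates for Beltrami fields\<close>

lemma real_mvt:
  fixes f :: "real \<Rightarrow> real"
  assumes "\<And>x. (f has_real_derivative f' x) (at x)"
  obtains z where "f x - f y = (x - y) * f' z" "\<bar>z - y\<bar> \<le> \<bar>x - y\<bar>"
proof (cases x y rule: linorder_cases)
  case less
  from MVT2[OF this, of f f'] assms obtain z where "x < z" "z < y" "f y - f x = (y - x) * f' z" by blast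
  then show ?thesis by (intro that[of z]) (auto simp: algebra_simps)
next
  case greater
  from MVT2[OF this, of f f'] assms obtain z where "y < z" "z < x" "f x - f y = (x - y) * f' z" by blast
  then show ?thesis by (intro that[of z]) auto
qed (use that[of y] in simp)

lemma abs_diff_le_derivative_bound:
  fixes f :: "real \<Rightarrow> real"
  assumes "\<And>x. (f has_real_derivative f' x) (at x)" "\<And>x. \<bar>f' x\<bar> \<le> 1"
  shows "\<bar>f x - f y\<bar> \<le> \<bar>x - y\<bar>"
proof -
  obtain z where "f x - f y = (x - y) * f' z" by (rule real_mvt[OF assms(1)])
  then show ?thesis using mult_left_mono[OF assms(2)[of z], of "\<bar>x - y\<bar>"] by (simp add: abs_mult)
qed

lemma abs_cos_diff_le: "\<bar>cos x - cos y\<bar> \<le> \<bar>x - y :: real\<bar>"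
  by (rule abs_diff_le_derivative_bound[where f' = "\<lambda>x. - sin x"]) (auto intro!: derivative_eq_intros)

lemma abs_sin_diff_le: "\<bar>sin x - sin y\<bar> \<le> \<bar>x - y :: real\<bar>"
  by (rule abs_diff_le_derivative_bound[where f' = cos]) (auto intro!: derivative_eq_intros)

text \<open>Only the quadratic order matters, so the constant 1 given by the mean value theorem
  suffices.\<close>

lemma taylor_from_lipschitz_derivative:
  fixes f :: "real \<Rightarrow> real"
  assumes "\<And>x. (f has_real_derivative f' x) (at x)" "\<And>x y. \<bar>f' x - f' y\<bar> \<le> \<bar>x - y\<bar>"
  shows "\<bar>f x - f y - (x - y) * f' y\<bar> \<le> (x - y)\<^sup>2"
proof -
  obtain z where z: "f x - f y = (x - y) * f' z" "\<bar>z - y\<bar> \<le> \<bar>x - y\<bar>"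
    by (rule real_mvt[OF assms(1)])
  have "\<bar>f x - f y - (x - y) * f' y\<bar> = \<bar>x - y\<bar> * \<bar>f' z - f' y\<bar>"
    unfolding z(1) by (simp add: abs_mult[symmetric] right_diff_distrib)
  also have "\<dots> \<le> \<bar>x - y\<bar> * \<bar>x - y\<bar>"
    using order_trans[OF assms(2) z(2)] by (intro mult_left_mono) auto
  finally show ?thesis by (simp add: power2_eq_square abs_mult[symmetric])
qed

lemma cos_taylor: "\<bar>cos x - cos y + (x - y) * sin y\<bar> \<le> (x - y :: real)\<^sup>2"
  using taylor_from_lipschitz_derivative[of cos "\<lambda>x. - sin x" x y] abs_sin_diff_le
  by (auto intro!: derivative_eq_intros simp: abs_minus_commute)

lemma sin_taylor: "\<bar>sin x - sin y - (x - y) * cos y\<bar> \<le> (x - y :: real)\<^sup>2"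
  using taylor_from_lipschitz_derivative[of sin cos x y] abs_cos_diff_le
  by (auto intro!: derivative_eq_intros)

context
  fixes l :: real and k :: "real^3"
  assumes l: "0 < l" and k: "k \<bullet> k = l\<^sup>2"
begin

lemma norm_wavevector: "norm k = l"
  using l k by (simp add: norm_eq_sqrt_inner)

lemma norm_wave_cos: "norm (wave_cos l k q) \<le> norm q"
proof -
  have "(norm (cross3 k q))\<^sup>2 \<le> (l * norm q)\<^sup>2"
    using norm_cross_dot[of k q] by (simp add: norm_wavevector)
       (metis le_add_same_cancel1 zero_le_power2)
  then have "norm (cross3 k q) \<le> l * norm q"
    by (rule power2_le_imp_le) (use l in simp)
  then show ?thesis
    using l by (simp add: wave_cos_def divide_simps mult.commute)
qed

text \<open>All five wave estimates below are of this shape, with trigonometric differences as the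
  scalars \<open>s\<close> and \<open>t\<close>; the factor 2 counts the two terms.\<close>

lemma norm_scaleR_pair:
  assumes "\<bar>s\<bar> \<le> m" "\<bar>t\<bar> \<le> m"
  shows "norm (s *\<^sub>R wave_cos l k q + t *\<^sub>R q) \<le> 2 * m * norm q"
proof -
  have "\<bar>s\<bar> * norm (wave_cos l k q) \<le> m * norm q" "\<bar>t\<bar> * norm q \<le> m * norm q"
    using assms by (auto intro!: mult_mono norm_wave_cos)
  then show ?thesis by (intro norm_triangle_le) simp
qed

lemma norm_wave: "norm (wave l k q s) \<le> 2 * norm q"
  unfolding wave_def using norm_scaleR_pair[of "cos s" 1 "sin s"] by simp

lemma norm_wave_deriv: "norm (wave_deriv l k q s) \<le> 2 * norm q"
  using norm_scaleR_pair[of "- sin s" 1 "cos s"] by (simp add: wave_deriv_def)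

lemma norm_wave_diff: "norm (wave l k q s - wave l k q t) \<le> 2 * \<bar>s - t\<bar> * norm q"
  using norm_scaleR_pair[OF abs_cos_diff_le abs_sin_diff_le, of s t]
  by (simp add: wave_def algebra_simps)

lemma norm_wave_deriv_diff: "norm (wave_deriv l k q s - wave_deriv l k q t) \<le> 2 * \<bar>s - t\<bar> * norm q"
proof -
  have "\<bar>- (sin s - sin t)\<bar> \<le> \<bar>s - t\<bar>" using abs_sin_diff_le[of s t] by simp
  from norm_scaleR_pair[OF this abs_cos_diff_le]
  show ?thesis by (simp add: wave_deriv_def algebra_simps)
qed

lemma norm_wave_taylor:
  "norm (wave l k q s - wave l k q t - (s - t) *\<^sub>R wave_deriv l k q t) \<le> 2 * (s - t)\<^sup>2 * norm q"
  using norm_scaleR_pair[OF cos_taylor sin_taylor, of s t]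
  by (simp add: wave_def wave_deriv_def algebra_simps)

end

lemma wave_diff: "wave l k (q - q') s = wave l k q s - wave l k q' s"
  by (simp add: wave_def wave_cos_def Cross3.right_diff_distrib algebra_simps)

lemma wave_deriv_diff: "wave_deriv l k (q - q') s = wave_deriv l k q s - wave_deriv l k q' s"
  by (simp add: wave_deriv_def wave_cos_def Cross3.right_diff_distrib algebra_simps)

lemma blinfun_beltrami_deriv:
  "blinfun_apply (Blinfun (beltrami_deriv l K q a x)) = beltrami_deriv l K q a x"
  by (rule bounded_linear_Blinfun_apply[OF has_derivative_bounded_linear[OF beltrami_has_derivative]])

text \<open>In the constant, 2 comes from the wave estimates, \<open>c\<close> from summing the
  amplitudes, and \<open>l\<^sup>2\<close> from at most two factors \<open>k \<bullet> h\<close>. As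
  \<open>1 \<le> l\<close>, it also covers the estimates with fewer such factors.\<close>

lemma small_flow_beltrami:
  fixes q :: "'p::real_normed_vector \<Rightarrow> real^3 \<Rightarrow> real^3"
  assumes g: "0 < T" "continuous_on {0..T} g" "\<And>t. t \<in> {0..T} \<Longrightarrow> \<bar>g t\<bar> \<le> 1"
    and l: "1 \<le> l" and K: "\<And>k. k \<in> K \<Longrightarrow> k \<bullet> k = l\<^sup>2"
    and c: "0 \<le> c"
    and q: "\<And>A B k. q (A - B) k = q A k - q B k" "\<And>A. (\<Sum>k\<in>K. norm (q A k)) \<le> c * norm A"
  shows "small_flow (\<lambda>A. beltrami l K (q A) a)
    (\<lambda>A x. Blinfun (beltrami_deriv l K (q A) a x)) g T (2 * l\<^sup>2 * c)"
proof -
  have l0: "0 < l" and ll: "1 \<le> l\<^sup>2" "l \<le> l\<^sup>2"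
    using l by (auto simp: power2_eq_square intro: order_trans)
  have bound: "norm (\<Sum>k\<in>K. f k) \<le> 2 * l\<^sup>2 * c * norm A * m"
    if "0 \<le> m" "\<And>k. k \<in> K \<Longrightarrow> norm (f k) \<le> 2 * (l\<^sup>2 * m) * norm (q A k)"
    for f :: "real^3 \<Rightarrow> real^3" and A m
  proof -
    have "norm (\<Sum>k\<in>K. f k) \<le> (\<Sum>k\<in>K. 2 * (l\<^sup>2 * m) * norm (q A k))"
      by (rule sum_norm_le) (rule that(2))
    also have "\<dots> = 2 * (l\<^sup>2 * m) * (\<Sum>k\<in>K. norm (q A k))"
      by (simp add: sum_distrib_left)
    also have "\<dots> \<le> 2 * (l\<^sup>2 * m) * (c * norm A)"
      using that(1) by (intro mult_left_mono q) auto
    finally show ?thesis by (simp add: mult_ac)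
  qed
  have inner: "\<bar>k \<bullet> h\<bar> \<le> l * norm h" if "k \<in> K" for k h
    using Cauchy_Schwarz_ineq2[of k h] norm_wavevector[OF l0 K[OF that]] by simp
  have arg: "k \<bullet> (x - a) - k \<bullet> (y - a) = k \<bullet> (x - y)" for k x y
    by (simp add: inner_diff_right)
  have weaken: "2 * s * norm z \<le> 2 * t * norm z" if "s \<le> t" for s t :: real and z :: "real^3"
    using that by (intro mult_right_mono) auto
  have deriv_bound: "norm (beltrami_deriv l K (q A) a x h) \<le> 2 * l\<^sup>2 * c * norm A * norm h" for A x h
    unfolding beltrami_deriv_def
  proof (rule bound)
    fix k assume k: "k \<in> K"
    have "\<bar>k \<bullet> h\<bar> * norm (wave_deriv l k (q A k) (k \<bullet> (x - a))) \<le> (l\<^sup>2 * norm h) * (2 * norm (q A k))"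
      using inner[OF k, of h] mult_right_mono[OF ll(2), of "norm h"]
      by (intro mult_mono norm_wave_deriv[OF l0 K[OF k]]) auto
    then show "norm ((k \<bullet> h) *\<^sub>R wave_deriv l k (q A k) (k \<bullet> (x - a))) \<le> 2 * (l\<^sup>2 * norm h) * norm (q A k)"
      by (simp add: mult_ac)
  qed simp
  have v_diff: "beltrami l K (q A) a x - beltrami l K (q B) a x = beltrami l K (q (A - B)) a x" for A B x
    by (simp add: beltrami_def q(1) wave_diff sum_subtractf)
  have D_diff: "Blinfun (beltrami_deriv l K (q A) a x) - Blinfun (beltrami_deriv l K (q B) a x) =
      Blinfun (beltrami_deriv l K (q (A - B)) a x)" for A B x
    by (rule blinfun_eqI)
      (simp add: blinfun.diff_left blinfun_beltrami_deriv beltrami_deriv_def q(1) wave_deriv_diff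
        scaleR_diff_right sum_subtractf)
  have v_bound: "norm (beltrami l K (q A) a x) \<le> 2 * l\<^sup>2 * c * norm A" for A x
  proof -
    have "norm (wave l k (q A k) (k \<bullet> (x - a))) \<le> 2 * (l\<^sup>2 * 1) * norm (q A k)" if "k \<in> K" for k
      using order_trans[OF norm_wave[OF l0 K[OF that]]] weaken[OF ll(1)] by simp
    from bound[OF _ this] show ?thesis by (simp add: beltrami_def)
  qed
  have D_bound: "norm (Blinfun (beltrami_deriv l K (q A) a x)) \<le> 2 * l\<^sup>2 * c * norm A" for A x
    using c by (intro norm_blinfun_bound) (auto simp: blinfun_beltrami_deriv deriv_bound)
  show ?thesis
  proof
    show "norm (beltrami l K (q A) a x - beltrami l K (q B) a x) \<le> 2 * l\<^sup>2 * c * norm (A - B)" for A B x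
      unfolding v_diff by (rule v_bound)
    show "beltrami l K (q 0) a x = 0" for x
      using v_diff[of 0 x 0] by simp
    show "norm (beltrami l K (q A) a x - beltrami l K (q A) a y) \<le> 2 * l\<^sup>2 * c * norm A * norm (x - y)" for A x y
      unfolding beltrami_def sum_subtractf[symmetric]
    proof (rule bound)
      fix k assume k: "k \<in> K"
      show "norm (wave l k (q A k) (k \<bullet> (x - a)) - wave l k (q A k) (k \<bullet> (y - a)))
          \<le> 2 * (l\<^sup>2 * norm (x - y)) * norm (q A k)"
        using inner[OF k, of "x - y"] mult_right_mono[OF ll(2), of "norm (x - y)"]
        by (intro order_trans[OF norm_wave_diff[OF l0 K[OF k]]] weaken) (simp add: arg)
    qed simp
    show "norm (beltrami l K (q A) a y - beltrami l K (q A) a x -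
        Blinfun (beltrami_deriv l K (q A) a x) (y - x)) \<le> 2 * l\<^sup>2 * c * norm A * (norm (y - x))\<^sup>2" for A x y
      unfolding blinfun_beltrami_deriv beltrami_def beltrami_deriv_def sum_subtractf[symmetric]
    proof (rule bound)
      fix k assume k: "k \<in> K"
      have "(k \<bullet> (y - x))\<^sup>2 \<le> l\<^sup>2 * (norm (y - x))\<^sup>2"
        using power_mono[OF inner[OF k, of "y - x"], of 2] by (simp add: power_mult_distrib)
      from order_trans[OF norm_wave_taylor[OF l0 K[OF k], of "q A k" "k \<bullet> (y - a)" "k \<bullet> (x - a)"] weaken] this
      show "norm (wave l k (q A k) (k \<bullet> (y - a)) - wave l k (q A k) (k \<bullet> (x - a)) -
          (k \<bullet> (y - x)) *\<^sub>R wave_deriv l k (q A k) (k \<bullet> (x - a)))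
          \<le> 2 * (l\<^sup>2 * (norm (y - x))\<^sup>2) * norm (q A k)"
        unfolding arg by blast
    qed simp
    show "norm (Blinfun (beltrami_deriv l K (q A) a x) - Blinfun (beltrami_deriv l K (q B) a x))
        \<le> 2 * l\<^sup>2 * c * norm (A - B)" for A B x
      unfolding D_diff by (rule D_bound)
    show "Blinfun (beltrami_deriv l K (q 0) a x) = 0" for x
      using D_diff[of 0 x 0] by simp
    show "norm (Blinfun (beltrami_deriv l K (q A) a x) - Blinfun (beltrami_deriv l K (q A) a y))
        \<le> 2 * l\<^sup>2 * c * norm A * norm (x - y)" for A x y
    proof (rule norm_blinfun_bound)
      fix h
      have "norm (beltrami_deriv l K (q A) a x h - beltrami_deriv l K (q A) a y h)
          \<le> 2 * l\<^sup>2 * c * norm A * (norm (x - y) * norm h)"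
        unfolding beltrami_deriv_def sum_subtractf[symmetric] scaleR_diff_right[symmetric]
      proof (rule bound)
        fix k assume k: "k \<in> K"
        have "norm (wave_deriv l k (q A k) (k \<bullet> (x - a)) - wave_deriv l k (q A k) (k \<bullet> (y - a)))
            \<le> 2 * (l * norm (x - y)) * norm (q A k)"
          using inner[OF k, of "x - y"]
          by (intro order_trans[OF norm_wave_deriv_diff[OF l0 K[OF k]]] weaken) (simp add: arg)
        then have "\<bar>k \<bullet> h\<bar> * norm (wave_deriv l k (q A k) (k \<bullet> (x - a)) - wave_deriv l k (q A k) (k \<bullet> (y - a)))
            \<le> (l * norm h) * (2 * (l * norm (x - y)) * norm (q A k))"
          using inner[OF k, of h] l0 by (intro mult_mono) auto
        then show "norm ((k \<bullet> h) *\<^sub>R (wave_deriv l k (q A k) (k \<bullet> (x - a)) - wave_deriv l k (q A k) (k \<bullet> (y - a))))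
            \<le> 2 * (l\<^sup>2 * (norm (x - y) * norm h)) * norm (q A k)"
          by (simp add: mult_ac power2_eq_square)
      qed simp
      then show "norm ((Blinfun (beltrami_deriv l K (q A) a x) - Blinfun (beltrami_deriv l K (q A) a y)) h)
          \<le> 2 * l\<^sup>2 * c * norm A * norm (x - y) * norm h"
        by (simp add: blinfun.diff_left blinfun_beltrami_deriv mult_ac)
    qed (use c in simp)
  qed (use g c in auto)
qed

section \<open>Matrices of operators and Liouville's formula\<close>

lemma norm_matrix_le:
  fixes B :: "(real^'n) \<Rightarrow>\<^sub>L (real^'m)"
  shows "norm (matrix (blinfun_apply B)) \<le> real CARD('m) * real CARD('n) * norm B"
proof -
  have "\<bar>matrix (blinfun_apply B) $ i $ j\<bar> \<le> norm B" for i j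
    using component_le_norm_cart[of "blinfun_apply B (axis j 1)" i] norm_blinfun[of B "axis j 1"]
    by (simp add: matrix_def)
  then have "norm (matrix (blinfun_apply B) $ i) \<le> (\<Sum>j\<in>(UNIV::'n set). norm B)" for i
    by (intro order_trans[OF norm_le_l1_cart] sum_mono)
  then have "(\<Sum>i\<in>(UNIV::'m set). norm (matrix (blinfun_apply B) $ i)) \<le> (\<Sum>i\<in>(UNIV::'m set). \<Sum>j\<in>(UNIV::'n set). norm B)"
    by (rule sum_mono)
  then show ?thesis
    using L2_set_le_sum[of UNIV "\<lambda>i. norm (matrix (blinfun_apply B) $ i)"] by (simp add: norm_vec_def mult_ac)
qed

lemma bounded_linear_matrix: "bounded_linear (\<lambda>B :: (real^'n) \<Rightarrow>\<^sub>L (real^'m). matrix (blinfun_apply B))"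
proof (rule bounded_linear_intro)
  show "norm (matrix (blinfun_apply B)) \<le> norm B * (real CARD('m) * real CARD('n))" for B :: "(real^'n) \<Rightarrow>\<^sub>L (real^'m)"
    using norm_matrix_le[of B] by (simp add: mult.commute)
qed (auto simp: matrix_def vec_eq_iff blinfun.add_left blinfun.scaleR_left)

text \<open>The derivative of \<open>det J\<close> is \<open>trace N * det J\<close>. In dimension 3
  the expanded determinant shows this once \<open>N t $ 3 $ 3\<close> is eliminated.\<close>

lemma liouville_3:
  fixes J N :: "real \<Rightarrow> real^3^3"
  assumes J: "\<And>t. t \<in> {0..T} \<Longrightarrow> (J has_vector_derivative N t ** J t) (at t within {0..T})"
    and N: "\<And>t. t \<in> {0..T} \<Longrightarrow> trace (N t) = 0"
    and t: "t \<in> {0..T}"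
  shows "det (J t) = det (J 0)"
proof -
  have comp: "((\<lambda>t. J t $ i $ j) has_real_derivative (N t ** J t) $ i $ j) (at t within {0..T})"
    if "t \<in> {0..T}" for t i j
    using bounded_linear.has_vector_derivative[OF bounded_linear_vec_nth
        bounded_linear.has_vector_derivative[OF bounded_linear_vec_nth J[OF that]]]
    by (simp add: has_real_derivative_iff_has_vector_derivative)
  have "((\<lambda>t. det (J t)) has_real_derivative 0) (at t within {0..T})" if "t \<in> {0..T}" for t
  proof -
    have N33: "N t $ 3 $ 3 = - N t $ 1 $ 1 - N t $ 2 $ 2"
      using N[OF that] by (simp add: trace_def sum_3)
    show ?thesis
      unfolding det_3
      by (rule derivative_eq_intros comp[OF that] refl)+
        (simp add: matrix_matrix_mult_def sum_3 N33 algebra_simps)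
  qed
  then have "\<exists>d. \<forall>t\<in>{0..T}. det (J t) = d"
    by (intro has_field_derivative_zero_constant) auto
  then show ?thesis using t by force
qed

section \<open>Realizing Jacobians\<close>

text \<open>One of each pair k, -k of integer vectors of length sqrt 2. Integrality gives
  periodicity, the common length a common curl eigenvalue.\<close>

definition wavevectors :: "(real^3) set" where
  "wavevectors = {vector [1, 1, 0], vector [1, -1, 0], vector [1, 0, 1], vector [1, 0, -1],
    vector [0, 1, 1], vector [0, 1, -1]}"

lemma finite_wavevectors: "finite wavevectors"
  by (simp add: wavevectors_def)

lemma wavevectors_inner: "k \<in> wavevectors \<Longrightarrow> k \<bullet> k = (sqrt 2)\<^sup>2"
  by (auto simp: wavevectors_def inner_vec_def sum_3)

lemma wavevectors_Ints: "k \<in> wavevectors \<Longrightarrow> k $ i \<in> \<int>"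
  using exhaust_3[of i] by (auto simp: wavevectors_def)

lemma sum_wavevectors:
  "(\<Sum>k\<in>wavevectors. f k) = f (vector [1, 1, 0]) + f (vector [1, -1, 0]) + f (vector [1, 0, 1])
    + f (vector [1, 0, -1]) + f (vector [0, 1, 1]) + f (vector [0, 1, -1])"
  by (simp add: wavevectors_def vec_eq_iff forall_3 add.assoc)

text \<open>The part of \<open>M *v k\<close> orthogonal to \<open>k\<close>, as a divergence-free
  wave requires; the denominator is \<open>k \<bullet> k = 2\<close>.\<close>

definition transverse :: "real^3^3 \<Rightarrow> real^3 \<Rightarrow> real^3" where
  "transverse M k = M *v k - ((k \<bullet> (M *v k)) / 2) *\<^sub>R k"

text \<open>Mapping \<open>M\<close> to the sum of \<open>transverse M k \<otimes> k\<close> over the six wave vectors multiplies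
  antisymmetric, off-diagonal symmetric and traceless diagonal matrices by 4, 2 and 3,
  respectively; the following matrix inverts it, after the entry \<open>(3, 3)\<close> has been adjusted to make
  the trace vanish.\<close>

definition preimage_matrix :: "real^3^3 \<Rightarrow> real^3^3" where
  "preimage_matrix A = (\<chi> i j. if i \<noteq> j then (3 * A $ i $ j + A $ j $ i) / 8
    else if i = 3 then - (A $ 1 $ 1 + A $ 2 $ 2) / 3 else A $ i $ i / 3)"

definition amplitude :: "real^3^3 \<Rightarrow> real^3 \<Rightarrow> real^3" where
  "amplitude A = transverse (preimage_matrix A)"

lemma linear_amplitude: "linear (\<lambda>A. amplitude A k)"
proof
  have add: "preimage_matrix (A + B) = preimage_matrix A + preimage_matrix B" for A B
    by (simp add: preimage_matrix_def vec_eq_iff field_simps)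
  have scale: "preimage_matrix (c *\<^sub>R A) = c *\<^sub>R preimage_matrix A" for c A
    by (simp add: preimage_matrix_def vec_eq_iff field_simps)
  show "amplitude (A + B) k = amplitude A k + amplitude B k" for A B
    by (simp add: amplitude_def transverse_def add matrix_vector_mult_add_rdistrib inner_add_right
        add_divide_distrib scaleR_add_left)
  show "amplitude (c *\<^sub>R A) k = c *\<^sub>R amplitude A k" for c A
    by (simp add: amplitude_def transverse_def scale scaleR_matrix_vector_assoc[symmetric]
        scaleR_diff_right)
qed

lemma inner_amplitude: "k \<in> wavevectors \<Longrightarrow> k \<bullet> amplitude A k = 0"
  by (simp add: amplitude_def transverse_def inner_diff_right wavevectors_inner)

lemma amplitude_bound:
  obtains c where "0 \<le> c" "\<And>A. (\<Sum>k\<in>wavevectors. norm (amplitude A k)) \<le> c * norm A"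
proof -
  have "\<forall>k. \<exists>b. 0 \<le> b \<and> (\<forall>A. norm (amplitude A k) \<le> b * norm A)"
    by (metis linear_bounded_pos[OF linear_amplitude] less_imp_le)
  then obtain b where b: "\<And>k. 0 \<le> b k" "\<And>k A. norm (amplitude A k) \<le> b k * norm A" by metis
  show ?thesis
  proof (rule that[of "\<Sum>k\<in>wavevectors. b k"])
    show "(\<Sum>k\<in>wavevectors. norm (amplitude A k)) \<le> (\<Sum>k\<in>wavevectors. b k) * norm A" for A
      unfolding sum_distrib_right by (intro sum_mono b)
  qed (simp add: sum_nonneg b)
qed

section \<open>Eight entries and the determinant\<close>

text \<open>The coordinates that remain on \<open>SL3\<close> near the identity, kept as a
  projection so that domain and target are the same matrix space.\<close>

definition zero_33 :: "real^3^3 \<Rightarrow> real^3^3" where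
  "zero_33 M = (\<chi> i j. if i = 3 \<and> j = 3 then 0 else M $ i $ j)"

lemma linear_zero_33: "linear zero_33"
  by (rule linearI) (simp_all add: zero_33_def vec_eq_iff)

lemma norm_zero_33: "norm (zero_33 M) \<le> norm M"
proof -
  have "norm (zero_33 M $ i) \<le> norm (M $ i)" for i
    by (rule norm_le_componentwise_cart) (simp add: zero_33_def)
  then show ?thesis by (rule norm_le_componentwise_cart)
qed

lemma zero_33_idem: "zero_33 (zero_33 M) = zero_33 M"
  by (simp add: zero_33_def vec_eq_iff)

text \<open>At the center every phase is 0, leaving the sum of the matrices with entries q_i k_j.
  Equality holds only up to the entry (3,3), because the gradient is trace-free while
  \<open>A\<close> is arbitrary.\<close>

lemma zero_33_deriv_at_center:
  "zero_33 (matrix (beltrami_deriv l wavevectors (amplitude A) a a)) = zero_33 A"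
proof -
  have "beltrami_deriv l wavevectors (amplitude A) a a (axis j 1) $ i =
      (\<Sum>k\<in>wavevectors. k $ j * amplitude A k $ i)" for i j
    by (simp add: beltrami_deriv_def wave_deriv_def inner_axis)
  then show ?thesis
    by (simp add: zero_33_def matrix_def vec_eq_iff forall_3)
      (simp add: sum_wavevectors amplitude_def transverse_def preimage_matrix_def
        matrix_vector_mult_def inner_vec_def sum_3 field_simps)
qed

lemma det_eq_imp_eq_33:
  fixes F G :: "real^3^3"
  assumes "zero_33 F = zero_33 G" "det F = det G" "F $ 1 $ 1 * F $ 2 $ 2 - F $ 1 $ 2 * F $ 2 $ 1 \<noteq> 0"
  shows "F = G"
proof -
  have e: "F $ i $ j = G $ i $ j" if "\<not> (i = 3 \<and> j = 3)" for i j
    using arg_cong[OF assms(1), of "\<lambda>M. M $ i $ j"] that by (simp add: zero_33_def del: de_Morgan_conj)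
  have "(F $ 1 $ 1 * F $ 2 $ 2 - F $ 1 $ 2 * F $ 2 $ 1) * (F $ 3 $ 3 - G $ 3 $ 3) = det F - det G"
    unfolding det_3 by (simp add: e[symmetric] algebra_simps)
  then have "F $ 3 $ 3 = G $ 3 $ 3" using assms(2,3) by simp
  then show ?thesis using e by (metis vec_eq_iff)
qed

text \<open>A solution is a fixed point of \<open>H\<close>. Half of the allowed size
  \<open>c * r\<close> goes to the quadratic error, by \<open>\<kappa> * r \<le> c / 2\<close>, and
  half to the distance of \<open>y\<close> from \<open>y0\<close>, so \<open>H\<close> maps the ball
  into itself.\<close>

lemma projected_surjective_near_scaling:
  fixes G P :: "'a::euclidean_space \<Rightarrow> 'a"
  assumes P: "linear P" "\<And>x. norm (P x) \<le> norm x" "\<And>x. P (P x) = P x"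
    and r: "0 < r" "0 < c" "0 \<le> \<kappa>" "\<kappa> * r \<le> c / 2"
    and G: "continuous_on (cball 0 r) G"
      "\<And>x. x \<in> cball 0 r \<Longrightarrow> norm (P (G x - y0 - c *\<^sub>R x)) \<le> \<kappa> * (norm x)\<^sup>2"
    and y: "norm (y - y0) \<le> c * r / 2"
  obtains x where "x \<in> cball 0 r" "P (G x) = P y"
proof -
  interpret P: linear P by fact
  define H where "H x = - (1 / c) *\<^sub>R P (G x - y - c *\<^sub>R x)" for x
  have "continuous_on (cball 0 r) H"
    unfolding H_def
    by (intro continuous_on_scaleR continuous_on_const linear_continuous_on_compose[OF _ P(1)]
        continuous_on_diff G(1) continuous_on_id)
  moreover have "H x \<in> cball 0 r" if x: "x \<in> cball 0 r" for x
  proof -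
    have "norm (P (G x - y0 - c *\<^sub>R x)) \<le> \<kappa> * r\<^sup>2"
      by (rule order_trans[OF G(2)[OF x] mult_left_mono[OF power_mono r(3)]]) (use x in auto)
    also have "\<dots> \<le> c / 2 * r"
      using mult_right_mono[OF r(4), of r] r(1) by (simp add: power2_eq_square)
    finally have "norm (P (G x - y0 - c *\<^sub>R x) - P (y - y0)) \<le> c * r"
      using order_trans[OF P(2) y] by (intro order_trans[OF norm_triangle_ineq4]) simp
    moreover have "P (G x - y0 - c *\<^sub>R x) - P (y - y0) = P (G x - y - c *\<^sub>R x)"
      by (simp only: P.diff[symmetric]) (simp add: algebra_simps)
    ultimately show ?thesis
      using r by (simp add: H_def divide_simps mult.commute)
  qed
  ultimately obtain x where x: "x \<in> cball 0 r" "H x = x"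
    using brouwer_ball[OF r(1)] by blast
  \<comment> \<open>A fixed point lies in the range of \<open>P\<close>, so the terms
    \<open>c *\<^sub>R x\<close> cancel.\<close>
  have "P x = x"
    using x(2) P(3) by (metis H_def P.scale)
  moreover have "c *\<^sub>R H x = - P (G x - y - c *\<^sub>R x)"
    using r(2) by (simp add: H_def)
  ultimately have "P (G x) = P y"
    by (simp add: x(2) P.diff P.scale)
  with x(1) show ?thesis by (rule that)
qed

lemma trace_beltrami_deriv_matrix:
  assumes "\<And>k. k \<in> K \<Longrightarrow> k \<bullet> q k = 0"
  shows "trace (matrix (beltrami_deriv l K q a x)) = 0"
  using trace_beltrami_deriv[OF assms] by (simp add: trace_def matrix_def)

theorem theorem2p2:
  fixes a :: "real^3" and T \<nu> :: real
  assumes "T > 0" and "\<nu> \<ge> 0"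
  shows "\<exists>U. openin (top_of_set SL3) U \<and> mat 1 \<in> U \<and>
    (\<forall>F\<in>U. \<exists>u p X.
       analytic_periodic_solution \<nu> T u p \<and>
       lagrangian_flow T u X \<and>
       (\<lambda>b. X b T) differentiable (at a) \<and>
       jacobian (\<lambda>b. X b T) (at a) = F)"
proof -
  define l where "l = sqrt 2"
  define g where "g t = exp (- (\<nu> * l\<^sup>2) * t)" for t
  obtain c where c: "0 \<le> c" "\<And>A. (\<Sum>k\<in>wavevectors. norm (amplitude A k)) \<le> c * norm A"
    by (rule amplitude_bound) blast
  define C where "C = 2 * l\<^sup>2 * c"
  define D where "D A x = Blinfun (beltrami_deriv l wavevectors (amplitude A) a x)" for A x
  have l: "1 \<le> l" "0 < l" "l \<noteq> 0" by (auto simp: l_def)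
  have K: "k \<in> wavevectors \<Longrightarrow> k \<bullet> k = l\<^sup>2" for k
    unfolding l_def by (rule wavevectors_inner)
  have g_cont: "continuous_on {0..T} g"
    unfolding g_def by (intro continuous_intros)
  have g_bounds: "0 \<le> g t" "g t \<le> 1" "g T \<le> g t" if "t \<in> {0..T}" for t
    using that assms by (auto simp: g_def intro!: mult_left_mono)
  interpret small_flow "\<lambda>A. beltrami l wavevectors (amplitude A) a" D g T C
    unfolding C_def D_def
    by (rule small_flow_beltrami[OF assms(1) g_cont _ l(1) K c(1) linear_diff[OF linear_amplitude] c(2)])
      (use g_bounds in auto)
  define \<tau> where "\<tau> = integral {0..T} g"
  \<comment> \<open>As \<open>g\<close> is smallest at \<open>T\<close>, its integral is at least
    \<open>T * g T > 0\<close>.\<close>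
  have "integral {0..T} (\<lambda>t. g T) \<le> \<tau>"
    unfolding \<tau>_def using g_cont g_bounds
    by (intro integral_le integrable_continuous_interval continuous_on_const) auto
  moreover have "0 < T * g T" using assms by (simp add: g_def)
  ultimately have \<tau>: "0 < \<tau>" using assms by simp
  let ?M = "\<lambda>B::(real^3) \<Rightarrow>\<^sub>L (real^3). matrix (blinfun_apply B)"
  interpret M: bounded_linear ?M by (rule bounded_linear_matrix)
  define G where "G A = matrix (blinfun_apply (tangent A a T))" for A
  \<comment> \<open>The velocity is divergence-free, so the determinant keeps its initial
    value.\<close>
  have det_G: "det (G A) = 1" if A: "small A" for A
  proof -
    have "((\<lambda>t. matrix (blinfun_apply (tangent A a t))) has_vector_derivative
        (g t *\<^sub>R matrix (blinfun_apply (D A (flow A a t)))) ** matrix (blinfun_apply (tangent A a t)))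
        (at t within {0..T})" if "t \<in> {0..T}" for t
    proof -
      have "matrix (blinfun_apply (g t *\<^sub>R (D A (flow A a t) o\<^sub>L tangent A a t))) =
          (g t *\<^sub>R matrix (blinfun_apply (D A (flow A a t)))) ** matrix (blinfun_apply (tangent A a t))"
        unfolding M.scaleR
        by (simp add: matrix_compose blinfun_compose.rep_eq blinfun.bounded_linear_right
            bounded_linear.linear scalar_matrix_assoc)
      then show ?thesis
        using bounded_linear.has_vector_derivative[OF bounded_linear_matrix
            tangent_has_vector_derivative[OF A that]] by metis
    qed
    moreover have "trace (g t *\<^sub>R matrix (blinfun_apply (D A x))) = 0" for t x
      using trace_beltrami_deriv_matrix[where K = wavevectors and q = "amplitude A", OF inner_amplitude]
      by (simp add: D_def blinfun_beltrami_deriv trace_def flip: sum_distrib_left)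
    ultimately have "det (G A) = det (matrix (blinfun_apply (tangent A a 0)))"
      unfolding G_def by (intro liouville_3) (use assms in auto)
    then show ?thesis
      by (simp add: tangent_0[OF A] id_blinfun.rep_eq matrix_id_mat_1[unfolded id_def])
  qed
  \<comment> \<open>The 9 is the cost of passing from operators to 3x3 matrices; the rest comes from
    \<open>tangent_expansion\<close>.\<close>
  define \<kappa> where "\<kappa> = 9 * (4 * C\<^sup>2 * T\<^sup>2)"
  have expansion: "norm (zero_33 (G A - mat 1 - \<tau> *\<^sub>R A)) \<le> \<kappa> * (norm A)\<^sup>2" if A: "small A" for A
  proof -
    have "?M (tangent A a T - id_blinfun - \<tau> *\<^sub>R D A a) = G A - mat 1 - \<tau> *\<^sub>R ?M (D A a)"
      by (simp add: M.diff M.scaleR G_def id_blinfun.rep_eq matrix_id_mat_1[unfolded id_def])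
    moreover have "zero_33 (G A - mat 1 - \<tau> *\<^sub>R ?M (D A a)) = zero_33 (G A - mat 1 - \<tau> *\<^sub>R A)"
      using zero_33_deriv_at_center[of l A a]
      by (simp add: linear_diff[OF linear_zero_33] linear_scale[OF linear_zero_33] D_def
          blinfun_beltrami_deriv)
    ultimately have "norm (zero_33 (G A - mat 1 - \<tau> *\<^sub>R A)) \<le> norm (?M (tangent A a T - id_blinfun - \<tau> *\<^sub>R D A a))"
      using norm_zero_33 by metis
    also have "\<dots> \<le> 9 * norm (tangent A a T - id_blinfun - \<tau> *\<^sub>R D A a)"
      using norm_matrix_le[of "tangent A a T - id_blinfun - \<tau> *\<^sub>R D A a"] by simp
    also have "\<dots> \<le> \<kappa> * (norm A)\<^sup>2"
      using tangent_expansion[OF A, of a] by (simp add: \<kappa>_def \<tau>_def mult_ac)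
    finally show ?thesis .
  qed
  have \<kappa>: "0 \<le> \<kappa>" by (simp add: \<kappa>_def)
  \<comment> \<open>The first term ensures \<open>small\<close> on the ball, the second
    \<open>\<kappa> * r \<le> \<tau> / 2\<close>; adding 1 keeps the denominators positive.\<close>
  define r where "r = min (1 / (2 * C * T + 1)) (\<tau> / (2 * \<kappa> + 1))"
  have CT: "0 \<le> C * T" using C T by simp
  have r0: "0 < r" using CT \<kappa> \<tau> by (simp add: r_def add_nonneg_pos)
  have r1: "C * T * r \<le> 1/2"
  proof -
    have "C * T * r \<le> C * T * (1 / (2 * C * T + 1))"
      by (rule mult_left_mono[OF _ CT]) (simp add: r_def)
    also have "\<dots> \<le> 1/2" using CT by (simp add: field_simps)
    finally show ?thesis .
  qed
  have r2: "\<kappa> * r \<le> \<tau> / 2"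
  proof -
    have "\<kappa> * r \<le> \<kappa> * (\<tau> / (2 * \<kappa> + 1))"
      by (rule mult_left_mono[OF _ \<kappa>]) (simp add: r_def)
    also have "\<dots> \<le> \<tau> / 2" using \<kappa> \<tau> by (simp add: field_simps)
    finally show ?thesis .
  qed
  have small: "small A" if "A \<in> cball 0 r" for A
    using mult_left_mono[OF _ CT, of "norm A" r] that r1 unfolding small_def by (simp add: mult_ac)
  have G_cont: "continuous_on (cball 0 r) G"
    unfolding G_def
    by (rule bounded_linear.continuous_on[OF bounded_linear_matrix continuous_on_subset[OF tangent_cont]])
      (use small in auto)
  \<comment> \<open>The radius is the one that the Brouwer argument allows for
    \<open>c = \<tau>\<close>; the positive minor lets \<open>det\<close> determine the entry
    (3,3).\<close>
  define U where "U = SL3 \<inter> (ball (mat 1) (\<tau> * r / 2) \<inter>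
    {F. 0 < F $ 1 $ 1 * F $ 2 $ 2 - F $ 1 $ 2 * F $ 2 $ 1})"
  have "openin (top_of_set SL3) U"
    unfolding U_def by (intro openin_open_Int open_Int open_ball open_Collect_less continuous_intros)
  moreover have "mat 1 \<in> U"
    using r0 \<tau> by (simp add: U_def SL3_def) (simp add: mat_def)
  moreover have "\<exists>u p X. analytic_periodic_solution \<nu> T u p \<and> lagrangian_flow T u X \<and>
      (\<lambda>b. X b T) differentiable (at a) \<and> jacobian (\<lambda>b. X b T) (at a) = F" if F: "F \<in> U" for F
  proof -
    have "norm (F - mat 1) \<le> \<tau> * r / 2"
      using F by (simp add: U_def dist_norm norm_minus_commute)
    then obtain A where A: "A \<in> cball 0 r" "zero_33 (G A) = zero_33 F"
      using projected_surjective_near_scaling[OF linear_zero_33 norm_zero_33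
          zero_33_idem r0 \<tau> \<kappa> r2 G_cont expansion[OF small]] by blast
    have s: "small A" by (rule small[OF A(1)])
    have "det F = det (G A)" "F $ 1 $ 1 * F $ 2 $ 2 - F $ 1 $ 2 * F $ 2 $ 1 \<noteq> 0"
      using F det_G[OF s] by (auto simp: U_def SL3_def)
    then have "F = G A"
      by (rule det_eq_imp_eq_33[OF A(2)[symmetric]])
    define u where "u t x = g t *\<^sub>R beltrami l wavevectors (amplitude A) a x" for t x
    show ?thesis
    proof (intro exI conjI)
      show "analytic_periodic_solution \<nu> T u (\<lambda>t x. - (u t x \<bullet> u t x) / 2)"
        unfolding u_def g_def
        by (rule beltrami_analytic_periodic_solution[OF assms(1) finite_wavevectors l(3)
              inner_amplitude K wavevectors_Ints])
      show "lagrangian_flow T u (flow A)"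
        unfolding lagrangian_flow_def u_def
        using flow_0[OF s] flow_has_vector_derivative[OF s] by blast
      show "(\<lambda>b. flow A b T) differentiable (at a)"
        using flow_has_derivative[OF s] by (rule differentiableI)
      show "jacobian (\<lambda>b. flow A b T) (at a) = F"
        using frechet_derivative_at[OF flow_has_derivative[OF s], of a] \<open>F = G A\<close>
        by (simp add: jacobian_def G_def)
    qed
  qed
  ultimately show ?thesis by blast
qed

end
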